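(* Let $\mathfrak{R} = (R; <, 0, 1, +, (\lambda\cdot)_{\lambda \in D})$ be an ordered vector space over an ordered division ring $D$, where $(R;<)$ is dense. Let $\mathcal{S}$ be a semilinear set system on $R^m$ parameterized by $Y \subseteq R^n$. Then there exist constants $C_1, C_2 > 0$ and an integer $0 \leq s \leq n$ such that $C_1 t^{s} < \pi_{\mathcal{S}}(t) < C_2 t^{s}$ for every integer $t \geq 1$.
   Context: A linear inequality in $\mathfrak{R}$ in variables $x=(x_1,\dots,x_k)$ is a formula $\lambda_1x_1+\dots+\lambda_kx_k < c$ or $\lambda_1x_1+\dots+\lambda_kx_k \le c$ with $\lambda_i \in D$ and $c \in R$. A set $X \subseteq R^k$ is semilinear if it is a finite union of solution sets of finite conjunctions of linear inequalities (equivalently, definable in $\mathfrak{R}$). A set system $\mathcal{S}=\{S_b \subseteq R^m : b \in Y\}$ with $Y \subseteq R^n$ is semilinear if $Y$ and $\{(a,b)\in R^m\times R^n : a \in S_b, b \in Y\}$ are semilinear. The shatter function is $\pi_{\mathcal{S}}(t) = \max\{|\{S\cap A : S \in \mathcal{S}\}| : A \subseteq R^m, |A| = t\}$. *)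

theory Defs
  imports Complex_Main
begin

(* The library's modules and vector spaces have commutative scalars, so left vector spaces over a
   division ring are introduced here.  The class zero_neq_one on 'r provides the constant 1 of the
   language; only 1 \<noteq> 0, not 0 < 1, is required of it. *)

locale ordered_left_vector_space =
  fixes scale ::
    "'d::{division_ring, linordered_ring_strict} \<Rightarrow>
     'r::{linordered_ab_group_add, dense_linorder, zero_neq_one} \<Rightarrow> 'r"  (infixr "*s" 75)
  assumes scale_right_distrib: "a *s (x + y) = a *s x + a *s y"
    and scale_left_distrib: "(a + b) *s x = a *s x + b *s x"
    and scale_scale: "a *s (b *s x) = (a * b) *s x"
    and scale_one: "1 *s x = x"
    and scale_pos: "0 < a \<Longrightarrow> 0 < x \<Longrightarrow> 0 < a *s x"

(* Points of R^k are lists of length k; the identification of R^m \<times> R^n with R^(m+n) is append. *)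

definition coord_space :: "nat \<Rightarrow> 'r list set" where
  "coord_space k = {x. length x = k}"

(* Only the coefficients with index less than the number k of variables are used. *)

datatype ('d, 'r) linear_ineq = Less "nat \<Rightarrow> 'd" 'r | Less_Eq "nat \<Rightarrow> 'd" 'r

primrec satisfies ::
  "('d \<Rightarrow> 'r \<Rightarrow> 'r) \<Rightarrow> 'r list \<Rightarrow> ('d, 'r::linordered_ab_group_add) linear_ineq \<Rightarrow> bool"
where
  "satisfies scale x (Less l c) \<longleftrightarrow> (\<Sum>i<length x. scale (l i) (x ! i)) < c"
| "satisfies scale x (Less_Eq l c) \<longleftrightarrow> (\<Sum>i<length x. scale (l i) (x ! i)) \<le> c"

definition semilinear ::
  "('d \<Rightarrow> 'r \<Rightarrow> 'r) \<Rightarrow> nat \<Rightarrow> 'r::linordered_ab_group_add list set \<Rightarrow> bool"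
where
  "semilinear scale k X \<longleftrightarrow>
    (\<exists>F :: ('d, 'r) linear_ineq set set. finite F \<and> (\<forall>\<Phi>\<in>F. finite \<Phi>) \<and>
       X = (\<Union>\<Phi>\<in>F. {x \<in> coord_space k. \<forall>\<phi>\<in>\<Phi>. satisfies scale x \<phi>}))"

definition semilinear_set_system ::
  "('d \<Rightarrow> 'r \<Rightarrow> 'r) \<Rightarrow> nat \<Rightarrow> nat \<Rightarrow> 'r::linordered_ab_group_add list set \<Rightarrow>
   ('r list \<Rightarrow> 'r list set) \<Rightarrow> bool"
where
  "semilinear_set_system scale m n Y S \<longleftrightarrow>
    Y \<subseteq> coord_space n \<and> (\<forall>b\<in>Y. S b \<subseteq> coord_space m) \<and>
    semilinear scale n Y \<and> semilinear scale (m + n) {a @ b | a b. b \<in> Y \<and> a \<in> S b}"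

(* The maximum is over numbers at most 2^t, and over a nonempty set as soon as U has t points. *)

definition shatter_function :: "'a set \<Rightarrow> 'a set set \<Rightarrow> nat \<Rightarrow> nat" where
  "shatter_function U \<S> t =
    Max {card {T \<inter> A | T. T \<in> \<S>} | A. A \<subseteq> U \<and> finite A \<and> card A = t}"

end

theory Submission
  imports Defs "HOL-Library.FuncSet"
begin

text \<open>Every set of the system is a union of cells of a hyperplane arrangement with finitely many
  normal directions. Split the parameter space into sign classes on which the same sign vectors
  occur at every parameter. On such a piece the germ at \<open>b\<close> of \<open>{b. a \<in> S b}\<close> depends only on the
  sign vector \<open>\<sigma>\<close> of \<open>(a, b)\<close>; let \<open>W \<sigma>\<close> be its space of periods. The exponent of the piece is the
  maximal size of a set of sign vectors none of which can be dropped without enlarging the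
  intersection of their \<open>W \<sigma>\<close>. Upper bound: every trace touches a point \<open>b\<close> whose common period
  space is as small as possible; by definable connectedness the germs are then constant along that
  space, so the trace is determined by an irredundant subset of the points, their sign vectors and
  one direction sign. Lower bound: if \<open>v\<^sub>\<sigma>\<close> is a period of all members of an irredundant set except
  \<open>\<sigma>\<close>, then translates of the germ of \<open>\<sigma>\<close> along \<open>v\<^sub>\<sigma>\<close> cut a grid independently for every \<open>\<sigma>\<close>.

  Since \<open>R\<close> need not be Archimedean over \<open>D\<close>, directions are vectors over \<open>D\<close>, and points move along
  \<open>v z\<close> with \<open>z > 0\<close> small in \<open>R\<close>.\<close>

text \<open>Germs turn the problem into one about finite data: they depend on sign vectors only, and
  their periods form spaces over \<open>'d\<close>, where linear algebra is available whatever
  \<open>'r\<close> looks like. The obstacle to the upper bound is that a parameter in general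
  position reveals nothing. If none of the hyperplanes belonging to the given points passes through
  it, all germs there are constant and every direction is a period, yet the trace changes further
  away. So the trace is read at a possibly more degenerate parameter, from which it is seen along an
  arbitrarily short step. Few common periods are what makes this parameter rigid: if the germs
  changed along a common period, the place of the change would touch the same trace and have
  strictly fewer periods. This argument moves through an ordered group that may have gaps, so it
  rests on a connectedness statement for semilinear sets only, obtained by eliminating variables.
  The bound \<open>s \<le> n\<close> is duality: the directions witnessing irredundance are dual to
  linear forms in \<open>n\<close> variables.\<close>

definition sg :: "'a::{linorder,zero} \<Rightarrow> int" where
  "sg x = (if 0 < x then 1 else if x < 0 then -1 else 0)"

lemma sg_zero [simp]: "sg 0 = 0" and sg_eq_0_iff [simp]: "sg x = 0 \<longleftrightarrow> x = 0"
  by (auto simp: sg_def)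

lemma sg_eq_1_iff: "sg x = 1 \<longleftrightarrow> 0 < x" and sg_eq_minus_1_iff: "sg x = - 1 \<longleftrightarrow> x < 0"
  by (auto simp: sg_def)

lemma sg_range: "sg x \<in> {- 1, 0, 1}"
  by (auto simp: sg_def)

text \<open>The filter of right neighbourhoods of 0, built from the order alone so that it serves
  \<open>'d\<close> and \<open>'r\<close> alike.\<close>

definition small :: "'a::{linorder,zero} filter" where
  "small = (INF d\<in>{0<..}. principal {0<..<d})"

text \<open>Points are functions on \<open>nat\<close> whose first \<open>k\<close> values count, so
  \<open>case_nat\<close> puts a coordinate in front when variables are eliminated. With
  \<open>scale\<close> as a parameter the same coefficients act on points over \<open>'r\<close>
  and, through \<open>dot\<close>, on directions over \<open>'d\<close>.\<close>

definition lin :: "('d \<Rightarrow> 'r \<Rightarrow> 'r::comm_monoid_add) \<Rightarrow> nat \<Rightarrow> (nat \<Rightarrow> 'd) \<Rightarrow> (nat \<Rightarrow> 'r) \<Rightarrow> 'r" where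
  "lin scale k l x = (\<Sum>i<k. scale (l i) (x i))"

abbreviation dot :: "nat \<Rightarrow> (nat \<Rightarrow> 'd) \<Rightarrow> (nat \<Rightarrow> 'd) \<Rightarrow> 'd::ring_1" where
  "dot \<equiv> lin (*)"

lemma lin_Suc_case_nat:
  "lin scale (Suc k) l (case_nat y x) = scale (l 0) y + lin scale k (l \<circ> Suc) x"
  unfolding lin_def sum.lessThan_Suc_shift by simp

text \<open>The axioms are chosen so that the scalars acting on themselves are a model too. Every
  fact is then available both for points over \<open>'r\<close> and, with the prefix
  \<open>self\<close>, for directions over \<open>'d\<close>.\<close>

locale left_ovs =
  fixes scale ::
    "'d::{division_ring, linordered_ring_strict} \<Rightarrow> 'r::linordered_ab_group_add \<Rightarrow> 'r"  (infixr "*s" 75)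
  assumes scale_right_distrib: "a *s (x + y) = a *s x + a *s y"
    and scale_left_distrib: "(a + b) *s x = a *s x + b *s x"
    and scale_scale: "a *s (b *s x) = (a * b) *s x"
    and scale_one: "1 *s x = x"
    and scale_pos: "0 < a \<Longrightarrow> 0 < x \<Longrightarrow> 0 < a *s x"
    and ex_pos: "\<exists>x::'r. 0 < x"
begin

lemma scale_zero_left [simp]: "0 *s x = 0"
  using scale_left_distrib[of 0 0 x] by simp

lemma scale_zero_right [simp]: "a *s 0 = 0"
  using scale_right_distrib[of a 0 0] by simp

lemma scale_minus_left: "(- a) *s x = - (a *s x)"
  using scale_left_distrib[of a "- a" x] by (simp add: eq_neg_iff_add_eq_0 add.commute)

lemma scale_minus_right: "a *s (- x) = - (a *s x)"
  using scale_right_distrib[of a x "- x"] by (simp add: eq_neg_iff_add_eq_0 add.commute)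

lemma scale_right_diff: "a *s (x - y) = a *s x - a *s y"
  using scale_right_distrib[of a x "- y"] by (simp add: scale_minus_right)

lemma scale_left_diff: "(a - b) *s x = a *s x - b *s x"
  using scale_left_distrib[of a "- b" x] by (simp add: scale_minus_left)

lemma scale_sum: "a *s (\<Sum>i\<in>A. u i) = (\<Sum>i\<in>A. a *s u i)"
  by (induction A rule: infinite_finite_induct) (auto simp: scale_right_distrib)

lemma sum_scale: "(\<Sum>i\<in>A. u i) *s x = (\<Sum>i\<in>A. u i *s x)"
  by (induction A rule: infinite_finite_induct) (auto simp: scale_left_distrib)

lemma scale_neg: "a < 0 \<Longrightarrow> 0 < x \<Longrightarrow> a *s x < 0"
  using scale_pos[of "- a" x] by (simp add: scale_minus_left)

lemma sg_scale: "0 < x \<Longrightarrow> sg (a *s x) = sg a"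
  using scale_pos[of a x] scale_neg[of a x] less_linear[of 0 a]
  by (elim disjE) (auto simp: sg_def)

lemma scale_strict_mono: "0 < a \<Longrightarrow> x < y \<Longrightarrow> a *s x < a *s y"
  using scale_pos[of a "y - x"] by (simp add: scale_right_diff)

lemma scale_inverse [simp]:
  assumes "a \<noteq> 0" shows "a *s inverse a *s x = x" "inverse a *s a *s x = x"
  using assms by (auto simp: scale_scale scale_one)

lemma zero_less_one_ring: "0 < (1::'d)"
  using zero_le_square[of "1::'d"] by (simp add: order_le_less)

lemma pos_inverse: "0 < (a::'d) \<Longrightarrow> 0 < inverse a"
proof (rule ccontr)
  assume a: "0 < a" "\<not> 0 < inverse a"
  then have "inverse a < 0" by (metis not_less_iff_gr_or_eq nonzero_imp_inverse_nonzero)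
  then have "a * inverse a < 0" by (rule mult_pos_neg[OF a(1)])
  moreover have "a * inverse a = 1" using a(1) by (metis less_irrefl right_inverse)
  ultimately show False using zero_less_one_ring by (metis order.asym)
qed

text \<open>The midpoint works: \<open>1 + 1\<close> is positive, hence invertible, so density comes
  from the scalars.\<close>

lemma ex_between:
  assumes "(x::'r) < y" shows "\<exists>z. x < z \<and> z < y"
proof -
  define h :: 'd where "h = inverse (1 + 1)"
  have two: "0 < (1 + 1 :: 'd)" using zero_less_one_ring by (intro add_pos_pos)
  then have h: "0 < h" unfolding h_def by (rule pos_inverse)
  have "h + h = (1 + 1) * h" by (simp only: distrib_right mult_1_left)
  also have "\<dots> = 1" unfolding h_def using two by (intro right_inverse) (metis less_irrefl)
  finally have hh: "h + h = 1" .
  have p: "0 < h *s (y - x)" using h assms by (simp add: scale_pos)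
  have "h *s (y - x) + h *s (y - x) = y - x"
    using scale_left_distrib[of h h "y - x"] hh by (simp add: scale_one)
  then have "h *s (y - x) < y - x" using p by (metis less_add_same_cancel1)
  then show ?thesis using p by (intro exI[of _ "x + h *s (y - x)"]) (simp add: less_diff_eq add.commute)
qed

lemma eventually_small: "eventually P (small::'r filter) \<longleftrightarrow> (\<exists>d>0. \<forall>x. 0 < x \<longrightarrow> x < d \<longrightarrow> P x)"
proof -
  have "eventually P (small::'r filter) \<longleftrightarrow> (\<exists>d\<in>{0<..}. eventually P (principal {0<..<d}))"
    unfolding small_def
  proof (rule eventually_INF_base)
    show "{0::'r<..} \<noteq> {}" using ex_pos by auto
    fix a b :: 'r assume "a \<in> {0<..}" "b \<in> {0<..}"
    then show "\<exists>x\<in>{0<..}. principal {0<..<x} \<le> inf (principal {0<..<a}) (principal {0<..<b})"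
      by (intro bexI[of _ "min a b"]) auto
  qed
  also have "\<dots> \<longleftrightarrow> (\<exists>d>0. \<forall>x. 0 < x \<longrightarrow> x < d \<longrightarrow> P x)"
    by (simp add: eventually_principal Bex_def Ball_def imp_conjL)
  finally show ?thesis .
qed

lemma small_not_bot: "(small::'r filter) \<noteq> bot"
  unfolding trivial_limit_def eventually_small using ex_between by blast

lemma ev_pos: "eventually (\<lambda>x::'r. 0 < x) small"
  unfolding eventually_small using ex_pos by blast

lemma ev_lt: "0 < d \<Longrightarrow> eventually (\<lambda>x::'r. x < d) small"
  unfolding eventually_small by blast

lemma ev_affine_pos:
  assumes "0 < p" shows "eventually (\<lambda>x. 0 < p + q *s x) small"
proof (cases "q < 0")
  case False
  have "0 < p + q *s x" if "0 < x" for x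
  proof (cases "q = 0")
    case False
    then have "0 < q *s x" using \<open>\<not> q < 0\<close> that by (intro scale_pos) auto
    then show ?thesis using assms by (simp add: add_pos_pos)
  qed (use assms in simp)
  then show ?thesis using ev_pos by (auto elim: eventually_mono)
next
  case True
  \<comment> \<open>The zero of \<open>p + q *s x\<close>. It exists because the slope is a scalar
    and can be inverted, which is why directions are taken over \<open>'d\<close>.\<close>
  define d where "d = inverse (- q) *s p"
  have "0 < d" unfolding d_def using True assms by (intro scale_pos pos_inverse) auto
  then show ?thesis
  proof (rule eventually_mono[OF ev_lt])
    fix x assume "x < d"
    then have "(- q) *s x < (- q) *s d" using True by (intro scale_strict_mono) auto
    also have "\<dots> = p" unfolding d_def using True by (intro scale_inverse) auto
    finally have "- (q *s x) < p" by (simp add: scale_minus_left)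
    then show "0 < p + q *s x" by (metis add.right_inverse add.commute add_less_cancel_left)
  qed
qed

text \<open>Near 0 the constant term outweighs every multiple of \<open>x\<close> unless it
  vanishes. Applied to all forms at once, this lexicographic rule becomes the composition
  \<open>cmp\<close> of sign vectors.\<close>

lemma ev_sg: "eventually (\<lambda>x. sg (p + q *s x) = (if p = 0 then sg q else sg p)) small"
proof -
  consider "p = 0" | "0 < p" | "p < 0" using less_linear by blast
  then show ?thesis
  proof cases
    case 1
    then show ?thesis using ev_pos by (auto elim: eventually_mono simp: sg_scale)
  next
    case 2
    from ev_affine_pos[OF this, of q] show ?thesis
      by (rule eventually_mono) (use 2 in \<open>auto simp: sg_def\<close>)
  next
    case 3
    then have "eventually (\<lambda>x. 0 < - p + (- q) *s x) small" by (intro ev_affine_pos) auto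
    then show ?thesis
    proof (rule eventually_mono)
      fix x assume "0 < - p + (- q) *s x"
      then have "0 < - (p + q *s x)" by (simp add: scale_minus_left)
      then have "p + q *s x < 0" by (simp only: neg_0_less_iff_less)
      then show "sg (p + q *s x) = (if p = 0 then sg q else sg p)"
        using 3 by (metis sg_eq_minus_1_iff less_irrefl)
    qed
  qed
qed

lemma lin_zero [simp]: "lin (*s) k l (\<lambda>_. 0) = 0"
  by (simp add: lin_def)

lemma lin_add: "lin (*s) k l (\<lambda>i. x i + y i) = lin (*s) k l x + lin (*s) k l y"
  by (simp add: lin_def scale_right_distrib sum.distrib)

lemma lin_diff: "lin (*s) k l (\<lambda>i. x i - y i) = lin (*s) k l x - lin (*s) k l y"
  by (simp add: lin_def scale_right_diff sum_subtractf)

lemma lin_diff_left: "lin (*s) k (\<lambda>i. l i - l' i) x = lin (*s) k l x - lin (*s) k l' x"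
  by (simp add: lin_def scale_left_diff sum_subtractf)

lemma lin_minus_left: "lin (*s) k (\<lambda>i. - l i) x = - lin (*s) k l x"
  by (simp add: lin_def scale_minus_left sum_negf)

lemma lin_mult_left: "lin (*s) k (\<lambda>i. a * l i) x = a *s lin (*s) k l x"
  by (simp add: lin_def scale_sum scale_scale)

lemma lin_scale_right: "lin (*s) k l (\<lambda>i. v i *s x) = dot k l v *s x"
  by (simp add: lin_def sum_scale scale_scale)

lemma lin_move: "lin (*s) k l (\<lambda>i. x i + v i *s z) = lin (*s) k l x + dot k l v *s z"
  by (simp add: lin_add lin_scale_right)

lemma ev_sg_lin:
  "eventually (\<lambda>z. sg (lin (*s) k l (\<lambda>i. x i + v i *s z) - c)
     = (if lin (*s) k l x = c then sg (dot k l v) else sg (lin (*s) k l x - c))) small"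
  using ev_sg[of "lin (*s) k l x - c" "dot k l v"] by (simp add: lin_move algebra_simps)

end

sublocale ordered_left_vector_space \<subseteq> left_ovs scale
proof
  show "\<exists>x::'r. 0 < x"
    by (meson less_linear neg_0_less_iff_less zero_neq_one)
qed (fact scale_right_distrib scale_left_distrib scale_scale scale_one scale_pos)+

interpretation self: left_ovs "(*) :: 'd::{division_ring, linordered_ring_strict} \<Rightarrow> 'd \<Rightarrow> 'd"
proof
  show "\<exists>x::'d. 0 < x"
    by (meson less_linear neg_0_less_iff_less zero_neq_one)
qed (auto simp: distrib_left distrib_right mult.assoc)

section \<open>Linear algebra and Fourier--Motzkin elimination\<close>

context left_ovs
begin

lemma scale_eq_0: "0 < x \<Longrightarrow> a *s x = 0 \<longleftrightarrow> a = 0"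
  by (metis sg_scale sg_eq_0_iff)

lemma zero_less_scale_iff:
  assumes "0 < a" shows "0 < a *s z \<longleftrightarrow> 0 < z"
proof -
  consider "z = 0" | "0 < z" | "z < 0" using less_linear by blast
  then show ?thesis
  proof cases
    case 3
    then have "0 < a *s (- z)" using assms by (intro scale_pos) simp_all
    then show ?thesis using 3 by (auto simp: scale_minus_right dest: less_asym)
  qed (use assms scale_pos in auto)
qed

lemma zero_less_scale_iff_neg: "a < 0 \<Longrightarrow> 0 < a *s z \<longleftrightarrow> z < 0"
  using zero_less_scale_iff[of "- a" "- z"] by (simp add: scale_minus_left scale_minus_right)

text \<open>A form vanishing on the common kernel of finitely many forms is a left combination of
  them, and such an identity can be evaluated at vectors over \<open>'r\<close> just as well. The
  induction splits off one form at a time, so the coefficients are never written down.\<close>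

lemma lin_kernel_transfer:
  assumes "finite Rs"
    and "\<forall>v. (\<forall>r\<in>Rs. dot k r v = 0) \<longrightarrow> dot k g v = 0"
    and "\<forall>r\<in>Rs. lin (*s) k r x = 0"
  shows "lin (*s) k g x = 0"
  using assms
proof (induction Rs arbitrary: g rule: finite_induct)
  case empty
  have "g i = 0" if "i < k" for i
  proof -
    have "dot k g (\<lambda>j. if j = i then 1 else 0) = g i"
      using that by (simp add: lin_def if_distrib[of "(*) (g _)"] cong: if_cong)
    then show ?thesis using empty(1) by fastforce
  qed
  then show ?case by (simp add: lin_def)
next
  case (insert r Rs)
  show ?case
  proof (cases "\<forall>v. (\<forall>r\<in>Rs. dot k r v = 0) \<longrightarrow> dot k r v = 0")
    case True
    then show ?thesis using insert by auto
  next
    case False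
    then obtain w where w: "\<forall>r\<in>Rs. dot k r w = 0" "dot k r w \<noteq> 0" by blast
    \<comment> \<open>Coefficients act from the left, so vectors over the noncommutative
      \<open>'d\<close> are normalised from the right.\<close>
    define u where "u = (\<lambda>i. w i * inverse (dot k r w))"
    have u: "\<forall>r\<in>Rs. dot k r u = 0" "dot k r u = 1"
      using w by (simp_all add: u_def self.lin_scale_right)
    \<comment> \<open>The multiple of \<open>r\<close> is chosen to make \<open>h\<close> vanish at
      \<open>u\<close>. Every \<open>v\<close> in the kernel of the smaller set differs from a
      vector in the kernel of the larger one by a multiple of \<open>u\<close>, so \<open>h\<close>
      vanishes on the smaller set's kernel.\<close>
    define h where "h = (\<lambda>i. g i - dot k g u * r i)"
    have "dot k h v = 0" if v: "\<forall>r\<in>Rs. dot k r v = 0" for v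
    proof -
      have "\<forall>r'\<in>insert r Rs. dot k r' (\<lambda>i. v i - u i * dot k r v) = 0"
        using u v by (simp add: self.lin_diff self.lin_scale_right)
      then have "dot k g (\<lambda>i. v i - u i * dot k r v) = 0"
        using insert.prems(1) by blast
      then have "dot k g v - dot k g u * dot k r v = 0"
        by (simp only: self.lin_diff self.lin_scale_right)
      then show ?thesis by (simp only: h_def self.lin_diff_left self.lin_mult_left)
    qed
    then have "lin (*s) k h x = 0" using insert by auto
    then show ?thesis using insert.prems(2)
      by (simp add: h_def lin_diff_left lin_mult_left)
  qed
qed

lemma ex_between_sets:
  assumes "finite A" "finite B" "\<forall>a\<in>A. \<forall>b\<in>B. a < (b::'r)"
  shows "\<exists>y. (\<forall>a\<in>A. a < y) \<and> (\<forall>b\<in>B. y < b)"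
proof -
  obtain e :: 'r where e: "0 < e" using ex_pos by blast
  show ?thesis
  proof (cases "A = {}")
    case True
    have "Min B - e < b" if "b \<in> B" for b
      using add_strict_increasing2[of "Min B" e b] Min_le[OF assms(2) that] e
      by (metis add.commute add_strict_increasing diff_less_eq)
    then show ?thesis using True by auto
  next
    case A: False
    show ?thesis
    proof (cases "B = {}")
      case True
      have "a < Max A + e" if "a \<in> A" for a
        using Max_ge[OF assms(1) that] e by (simp add: add_strict_increasing2 less_add_same_cancel1 le_less_trans)
      then show ?thesis using True by auto
    next
      case False
      then have "Max A < Min B" using A assms by simp
      then obtain z where "Max A < z" "z < Min B" using ex_between by blast
      then show ?thesis using A False assms by auto
    qed
  qed
qed

text \<open>A constraint \<open>(e, l, c)\<close> is the equation \<open>l x = c\<close> if \<open>e\<close> holds and the strict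
  inequality \<open>l x > c\<close> otherwise; solution sets are thus open in their affine hulls.\<close>

definition sat :: "nat \<Rightarrow> (nat \<Rightarrow> 'r) \<Rightarrow> bool \<times> (nat \<Rightarrow> 'd) \<times> 'r \<Rightarrow> bool" where
  "sat k x = (\<lambda>(e, l, c). if e then lin (*s) k l x = c else c < lin (*s) k l x)"

definition basic :: "nat \<Rightarrow> (nat \<Rightarrow> 'r) set \<Rightarrow> bool" where
  "basic k X \<longleftrightarrow> (\<exists>\<Phi>. finite \<Phi> \<and> X = {x. \<forall>\<phi>\<in>\<Phi>. sat k x \<phi>})"

lemma sat_upper:
  assumes "l 0 < 0"
  shows "sat (Suc k) (case_nat y x) (False, l, c) \<longleftrightarrow> y < inverse (l 0) *s (c - lin (*s) k (l \<circ> Suc) x)"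
proof -
  have "c < l 0 *s y + lin (*s) k (l \<circ> Suc) x \<longleftrightarrow> 0 < l 0 *s (y - inverse (l 0) *s (c - lin (*s) k (l \<circ> Suc) x))"
    using assms by (simp add: scale_right_diff[of "l 0"] algebra_simps)
  also have "\<dots> \<longleftrightarrow> y - inverse (l 0) *s (c - lin (*s) k (l \<circ> Suc) x) < 0"
    using assms by (rule zero_less_scale_iff_neg)
  finally show ?thesis by (simp add: sat_def lin_Suc_case_nat)
qed

lemma sat_lower:
  assumes "0 < l 0"
  shows "sat (Suc k) (case_nat y x) (False, l, c) \<longleftrightarrow> inverse (l 0) *s (c - lin (*s) k (l \<circ> Suc) x) < y"
proof -
  have "c < l 0 *s y + lin (*s) k (l \<circ> Suc) x \<longleftrightarrow> 0 < l 0 *s (y - inverse (l 0) *s (c - lin (*s) k (l \<circ> Suc) x))"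
    using assms by (simp add: scale_right_diff[of "l 0"] algebra_simps)
  also have "\<dots> \<longleftrightarrow> 0 < y - inverse (l 0) *s (c - lin (*s) k (l \<circ> Suc) x)"
    using assms by (rule zero_less_scale_iff)
  finally show ?thesis by (simp add: sat_def lin_Suc_case_nat)
qed

lemma eq_iff_if_diff_eq: "u = v \<longleftrightarrow> u' = v'" and less_iff_if_diff_eq: "v < u \<longleftrightarrow> v' < u'"
  if "u - v = u' - (v'::'r)"
  by (metis eq_iff_diff_eq_0 that) (metis diff_gt_0_iff_gt that)

text \<open>One step of Fourier--Motzkin elimination. An equation involving the first coordinate
  allows a substitution. Otherwise only strict bounds remain, and by density they can be met exactly
  when each lower bound lies below each upper one. Both cases lead back to equations and strict
  inequalities.\<close>

lemma basic_project:
  assumes "basic (Suc k) X" shows "basic k {x. \<exists>y. case_nat y x \<in> X}"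
proof -
  obtain \<Phi> where \<Phi>: "finite \<Phi>" and X: "X = {x. \<forall>\<phi>\<in>\<Phi>. sat (Suc k) x \<phi>}"
    using assms unfolding basic_def by blast
  show ?thesis
  proof (cases "\<exists>l c. (True, l, c) \<in> \<Phi> \<and> l 0 \<noteq> 0")
    case True
    then obtain l0 c0 where 0: "(True, l0, c0) \<in> \<Phi>" "l0 0 \<noteq> 0" by blast
    \<comment> \<open>A multiple of the equation \<open>l0 x = c0\<close> is subtracted from each
      constraint to cancel its leading coefficient; \<open>Y x\<close> is the only value the
      eliminated coordinate can take.\<close>
    define sub :: "bool \<times> (nat \<Rightarrow> 'd) \<times> 'r \<Rightarrow> _"
      where "sub = (\<lambda>(e, l, c). (e, \<lambda>j. l (Suc j) - (l 0 * inverse (l0 0)) * l0 (Suc j), c - (l 0 * inverse (l0 0)) *s c0))"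
    define Y where "Y x = inverse (l0 0) *s (c0 - lin (*s) k (l0 \<circ> Suc) x)" for x
    have Y: "y = Y x" if "sat (Suc k) (case_nat y x) (True, l0, c0)" for x y
    proof -
      have "c0 - lin (*s) k (l0 \<circ> Suc) x = l0 0 *s y"
        using that by (auto simp: sat_def lin_Suc_case_nat)
      then show ?thesis using 0(2) by (simp add: Y_def)
    qed
    have S: "sat (Suc k) (case_nat (Y x) x) \<phi> \<longleftrightarrow> sat k x (sub \<phi>)" for x \<phi>
    proof -
      obtain e l c where \<phi>: "\<phi> = (e, l, c)" by (cases \<phi>)
      define a where "a = l 0 * inverse (l0 0)"
      have "lin (*s) (Suc k) l (case_nat (Y x) x) - c
          = lin (*s) k (\<lambda>j. l (Suc j) - a * l0 (Suc j)) x - (c - a *s c0)"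
        by (simp add: lin_Suc_case_nat Y_def scale_scale flip: a_def)
          (simp add: scale_right_diff lin_diff_left lin_mult_left o_def algebra_simps)
      from eq_iff_if_diff_eq[OF this] less_iff_if_diff_eq[OF this] show ?thesis unfolding \<phi> sat_def sub_def
        by (cases e) (simp_all flip: a_def)
    qed
    have "{x. \<exists>y. case_nat y x \<in> X} = {x. \<forall>\<phi>\<in>sub ` \<Phi>. sat k x \<phi>}"
    proof (intro set_eqI iffI)
      fix x assume "x \<in> {x. \<exists>y. case_nat y x \<in> X}"
      then obtain y where y: "\<forall>\<phi>\<in>\<Phi>. sat (Suc k) (case_nat y x) \<phi>" unfolding X by blast
      then have "y = Y x" using 0 Y by blast
      then show "x \<in> {x. \<forall>\<phi>\<in>sub ` \<Phi>. sat k x \<phi>}" using y S by auto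
    next
      fix x assume "x \<in> {x. \<forall>\<phi>\<in>sub ` \<Phi>. sat k x \<phi>}"
      then have "case_nat (Y x) x \<in> X" using S by (simp add: X)
      then show "x \<in> {x. \<exists>y. case_nat y x \<in> X}" by blast
    qed
    moreover have "finite (sub ` \<Phi>)" using \<Phi> by simp
    ultimately show ?thesis unfolding basic_def by (intro exI conjI)
  next
    case False
    define bd where "bd x = (\<lambda>(l::nat \<Rightarrow> 'd, c). inverse (l 0) *s (c - lin (*s) k (l \<circ> Suc) x))" for x
    define Lo where "Lo = {(l, c). (False, l, c) \<in> \<Phi> \<and> 0 < l 0}"
    define Up where "Up = {(l, c). (False, l, c) \<in> \<Phi> \<and> l 0 < 0}"
    define Re where "Re = {(e, l, c). (e, l, c) \<in> \<Phi> \<and> l 0 = 0}"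
    define tail :: "bool \<times> (nat \<Rightarrow> 'd) \<times> 'r \<Rightarrow> _" where "tail = (\<lambda>(e, l, c). (e, l \<circ> Suc, c))"
    \<comment> \<open>The comparison of a lower with an upper bound, with everything depending on
      \<open>x\<close> collected on one side.\<close>
    define pair :: "((nat \<Rightarrow> 'd) \<times> 'r) \<times> ((nat \<Rightarrow> 'd) \<times> 'r) \<Rightarrow> _"
      where "pair = (\<lambda>((l, c), (l', c')). (False,
        \<lambda>j. inverse (l 0) * l (Suc j) - inverse (l' 0) * l' (Suc j),
        inverse (l 0) *s c - inverse (l' 0) *s c'))"
    have fin: "finite Lo" "finite Up" "finite Re"
    proof -
      have "Lo \<subseteq> snd ` \<Phi>" "Up \<subseteq> snd ` \<Phi>" "Re \<subseteq> \<Phi>" by (force simp: Lo_def Up_def Re_def)+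
      then show "finite Lo" "finite Up" "finite Re" using \<Phi> finite_subset by blast+
    qed
    have pair: "sat k x (pair (p, q)) \<longleftrightarrow> bd x p < bd x q" for x p q
    proof -
      obtain l c l' c' where pq: "p = (l, c)" "q = (l', c')" by (cases p, cases q)
      have "bd x q - bd x p = lin (*s) k (\<lambda>j. inverse (l 0) * l (Suc j) - inverse (l' 0) * l' (Suc j)) x
           - (inverse (l 0) *s c - inverse (l' 0) *s c')"
        by (simp add: pq bd_def scale_right_diff lin_diff_left lin_mult_left o_def algebra_simps)
      from less_iff_if_diff_eq[OF this] show ?thesis unfolding pq sat_def pair_def by simp
    qed
    have all: "(\<forall>\<phi>\<in>\<Phi>. sat (Suc k) (case_nat y x) \<phi>) \<longleftrightarrow>
       (\<forall>\<phi>\<in>tail ` Re. sat k x \<phi>) \<and> (\<forall>p\<in>Lo. bd x p < y) \<and> (\<forall>p\<in>Up. y < bd x p)" (is "?l \<longleftrightarrow> ?r") for x y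
    proof -
      have re: "sat (Suc k) (case_nat y x) (e, l, c) \<longleftrightarrow> sat k x (tail (e, l, c))" if "l 0 = 0" for e l c
        using that by (simp add: sat_def tail_def lin_Suc_case_nat)
      show ?thesis
      proof
        assume ?l
        then show ?r using re
          by (auto simp: Re_def Lo_def Up_def bd_def simp flip: sat_upper sat_lower)
      next
        assume r: ?r
        show ?l
        proof
          fix \<phi> assume \<phi>: "\<phi> \<in> \<Phi>"
          obtain e l c where e: "\<phi> = (e, l, c)" by (cases \<phi>)
          consider "l 0 = 0" | "\<not> e" "0 < l 0" | "\<not> e" "l 0 < 0"
            using False \<phi> e less_linear[of 0 "l 0"] by (cases e) auto
          then show "sat (Suc k) (case_nat y x) \<phi>"
          proof cases
            case 1
            then have "(e, l, c) \<in> Re" using \<phi> e by (simp add: Re_def)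
            then show ?thesis using r re[of l e c] 1 e by blast
          next
            case 2
            then have "(l, c) \<in> Lo" using \<phi> e by (simp add: Lo_def)
            then show ?thesis using r 2 by (auto simp: sat_lower bd_def e)
          next
            case 3
            then have "(l, c) \<in> Up" using \<phi> e by (simp add: Up_def)
            then show ?thesis using r 3 by (auto simp: sat_upper bd_def e)
          qed
        qed
      qed
    qed
    have "{x. \<exists>y. case_nat y x \<in> X} = {x. \<forall>\<phi>\<in>tail ` Re \<union> pair ` (Lo \<times> Up). sat k x \<phi>}"
    proof (intro set_eqI iffI)
      fix x assume "x \<in> {x. \<exists>y. case_nat y x \<in> X}"
      then obtain y where "\<forall>\<phi>\<in>\<Phi>. sat (Suc k) (case_nat y x) \<phi>" unfolding X by blast
      then have "\<forall>\<phi>\<in>tail ` Re. sat k x \<phi>" "\<forall>p\<in>Lo. \<forall>q\<in>Up. sat k x (pair (p, q))"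
        unfolding all pair by (blast intro: less_trans)+
      then show "x \<in> {x. \<forall>\<phi>\<in>tail ` Re \<union> pair ` (Lo \<times> Up). sat k x \<phi>}" by blast
    next
      fix x assume x: "x \<in> {x. \<forall>\<phi>\<in>tail ` Re \<union> pair ` (Lo \<times> Up). sat k x \<phi>}"
      then have "\<forall>a\<in>bd x ` Lo. \<forall>b\<in>bd x ` Up. a < b"
        by (auto simp flip: pair)
      then obtain y where "(\<forall>a\<in>bd x ` Lo. a < y) \<and> (\<forall>b\<in>bd x ` Up. y < b)"
        using ex_between_sets fin by (metis finite_imageI)
      then have "\<forall>\<phi>\<in>\<Phi>. sat (Suc k) (case_nat y x) \<phi>" unfolding all using x by auto
      then show "x \<in> {x. \<exists>y. case_nat y x \<in> X}" unfolding X by blast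
    qed
    moreover have "finite (tail ` Re \<union> pair ` (Lo \<times> Up))" using fin by simp
    ultimately show ?thesis unfolding basic_def by (intro exI conjI)
  qed
qed

end

text \<open>The pairing matrix of forms and vectors is diagonal with nonzero entries, so the forms
  are independent. Gaussian elimination in the last coordinate with pivot \<open>p0\<close> lowers
  \<open>n\<close> by one at the price of one index.\<close>

lemma card_le_dim:
  fixes l v :: "'k \<Rightarrow> nat \<Rightarrow> 'd::division_ring"
  assumes "finite K" "\<forall>p\<in>K. dot n (l p) (v p) \<noteq> 0"
    "\<forall>p\<in>K. \<forall>q\<in>K. p \<noteq> q \<longrightarrow> dot n (l p) (v q) = 0"
  shows "card K \<le> n"
  using assms
proof (induction n arbitrary: K l)
  case 0
  then show ?case by (cases "K = {}") (auto simp: lin_def)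
next
  case (Suc n)
  have S: "dot (Suc n) a b = dot n a b + a n * b n" for a b :: "nat \<Rightarrow> 'd"
    by (simp add: lin_def)
  show ?case
  proof (cases "\<forall>p\<in>K. l p n = 0")
    case True
    then have "card K \<le> n" using Suc by (intro Suc.IH[of K l]) (auto simp: S)
    then show ?thesis by simp
  next
    case False
    then obtain p0 where p0: "p0 \<in> K" "l p0 n \<noteq> 0" by blast
    define l' where "l' p i = l p i - l p n * inverse (l p0 n) * l p0 i" for p i
    have d: "dot (Suc n) (l' p) w = dot (Suc n) (l p) w - l p n * inverse (l p0 n) * dot (Suc n) (l p0) w" for p w
      by (simp add: lin_def l'_def left_diff_distrib sum_subtractf sum_distrib_left distrib_left mult.assoc
          flip: sum.lessThan_Suc)
    have "l' p n = 0" for p using p0 by (simp add: l'_def mult.assoc)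
    then have d': "dot n (l' p) w = dot (Suc n) (l p) w - l p n * inverse (l p0 n) * dot (Suc n) (l p0) w" for p w
      unfolding d[symmetric] by (simp add: S)
    \<comment> \<open>The form \<open>l p0\<close> kills every vector \<open>v q\<close> with
      \<open>q \<noteq> p0\<close>, so the elimination changes none of the remaining
      pairings.\<close>
    have "card (K - {p0}) \<le> n"
      using Suc.prems p0 by (intro Suc.IH[of _ l']) (auto simp: d')
    then show ?thesis using Suc.prems p0 by simp
  qed
qed

section \<open>Definable connectedness\<close>

context left_ovs
begin

section \<open>Sign classes and sets that are unions of them\<close>

definition sgeq :: "nat \<Rightarrow> ((nat \<Rightarrow> 'd) \<times> 'r) set \<Rightarrow> (nat \<Rightarrow> 'r) \<Rightarrow> (nat \<Rightarrow> 'r) \<Rightarrow> bool" where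
  "sgeq k L x y \<longleftrightarrow> (\<forall>(l, c)\<in>L. sg (lin (*s) k l x - c) = sg (lin (*s) k l y - c))"

text \<open>Stating that finitely many signs decide membership makes boolean combinations immediate.
  Since there are finitely many sign classes and each of them is \<open>basic\<close>, projection
  reduces to a single elimination step.\<close>

definition semilin :: "nat \<Rightarrow> (nat \<Rightarrow> 'r) set \<Rightarrow> bool" where
  "semilin k X \<longleftrightarrow> (\<exists>L. finite L \<and> (\<forall>x y. sgeq k L x y \<longrightarrow> (x \<in> X \<longleftrightarrow> y \<in> X)))"

lemma sgeq_refl: "sgeq k L x x"
  and sgeq_sym: "sgeq k L x y \<Longrightarrow> sgeq k L y x"
  and sgeq_trans: "sgeq k L x y \<Longrightarrow> sgeq k L y z \<Longrightarrow> sgeq k L x z"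
  and sgeq_mono: "sgeq k L x y \<Longrightarrow> L' \<subseteq> L \<Longrightarrow> sgeq k L' x y"
  unfolding sgeq_def by fastforce+

lemma finite_sgclasses:
  assumes "finite L" shows "finite (range (\<lambda>x. {y. sgeq k L x y}))"
proof -
  define pat where "pat x = (\<lambda>p. if p \<in> L then sg (lin (*s) k (fst p) x - snd p) else 0)" for x
  have "pat x = pat y \<longleftrightarrow> sgeq k L x y" for x y
    unfolding sgeq_def pat_def fun_eq_iff by (auto split: if_splits)
  then have "range (\<lambda>x. {y. sgeq k L x y}) = (\<lambda>f. {y. f = pat y}) ` range pat" by auto
  moreover have "range pat \<subseteq> {f. \<forall>p. (p \<in> L \<longrightarrow> f p \<in> {- 1, 0, 1}) \<and> (p \<notin> L \<longrightarrow> f p = 0)}"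
  proof -
    have "pat x p \<in> {- 1, 0, 1}" for x p using sg_range[of "lin (*s) k (fst p) x - snd p"] by (simp add: pat_def)
    moreover have "pat x p = 0" if "p \<notin> L" for x p using that by (simp add: pat_def)
    ultimately show ?thesis by blast
  qed
  moreover have "finite {f :: _ \<Rightarrow> int. \<forall>p. (p \<in> L \<longrightarrow> f p \<in> {- 1, 0, 1}) \<and> (p \<notin> L \<longrightarrow> f p = 0)}"
    using assms by (intro finite_set_of_finite_funs) auto
  ultimately show ?thesis by (auto intro: finite_subset)
qed

lemma basic_sgclass:
  assumes "finite L" shows "basic k {y. sgeq k L x y}"
proof -
  define \<Phi> where "\<Phi> = (\<lambda>(l, c). if lin (*s) k l x = c then (True, l, c)
     else if c < lin (*s) k l x then (False, l, c) else (False, \<lambda>i. - l i, - c)) ` L"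
  have "sg (lin (*s) k l x - c) = sg (lin (*s) k l y - c) \<longleftrightarrow>
     sat k y (if lin (*s) k l x = c then (True, l, c)
     else if c < lin (*s) k l x then (False, l, c) else (False, \<lambda>i. - l i, - c))" for y l c
    using less_linear[of c "lin (*s) k l x"]
  proof (elim disjE)
    assume "c < lin (*s) k l x"
    then have "sg (lin (*s) k l x - c) = 1" "lin (*s) k l x \<noteq> c" by (auto simp: sg_eq_1_iff)
    moreover have "1 = sg (lin (*s) k l y - c) \<longleftrightarrow> c < lin (*s) k l y"
      by (metis diff_gt_0_iff_gt sg_eq_1_iff)
    ultimately show ?thesis using \<open>c < lin (*s) k l x\<close> by (simp add: sat_def)
  next
    assume "lin (*s) k l x < c"
    then have "sg (lin (*s) k l x - c) = -1" "lin (*s) k l x \<noteq> c" "\<not> c < lin (*s) k l x"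
      by (auto simp: sg_eq_minus_1_iff)
    moreover have "- 1 = sg (lin (*s) k l y - c) \<longleftrightarrow> lin (*s) k l y < c"
      by (metis diff_less_0_iff_less sg_eq_minus_1_iff)
    ultimately show ?thesis by (simp add: sat_def lin_minus_left)
  qed (simp add: sat_def eq_commute[of 0])
  then have "{y. sgeq k L x y} = {y. \<forall>\<phi>\<in>\<Phi>. sat k y \<phi>}"
    unfolding sgeq_def \<Phi>_def by auto
  moreover have "finite \<Phi>" using assms by (simp add: \<Phi>_def)
  ultimately show ?thesis unfolding basic_def by (intro exI conjI)
qed

lemma semilin_basic: assumes "basic k X" shows "semilin k X"
proof -
  obtain \<Phi> where \<Phi>: "finite \<Phi>" "X = {x. \<forall>\<phi>\<in>\<Phi>. sat k x \<phi>}" using assms unfolding basic_def by blast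
  have "x \<in> X \<longleftrightarrow> y \<in> X" if "sgeq k (snd ` \<Phi>) x y" for x y
  proof -
    have "sat k x \<phi> \<longleftrightarrow> sat k y \<phi>" if "\<phi> \<in> \<Phi>" for \<phi>
    proof -
      obtain e l c where e: "\<phi> = (e, l, c)" by (cases \<phi>)
      then have "(l, c) \<in> snd ` \<Phi>" using that by force
      then have "sg (lin (*s) k l x - c) = sg (lin (*s) k l y - c)"
        using \<open>sgeq k (snd ` \<Phi>) x y\<close> unfolding sgeq_def by blast
      then show ?thesis unfolding e sat_def
        by (auto simp: sg_def split: if_splits)
    qed
    then show ?thesis using \<Phi>(2) by blast
  qed
  then show ?thesis unfolding semilin_def using \<Phi>(1) by blast
qed

lemma semilin_UN:
  assumes "finite I" "\<And>i. i \<in> I \<Longrightarrow> semilin k (X i)" shows "semilin k (\<Union>i\<in>I. X i)"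
proof -
  have ex: "\<forall>i\<in>I. \<exists>L. finite L \<and> (\<forall>x y. sgeq k L x y \<longrightarrow> (x \<in> X i \<longleftrightarrow> y \<in> X i))"
    using assms(2) unfolding semilin_def by blast
  then obtain L where L: "\<And>i. i \<in> I \<Longrightarrow> finite (L i)"
    "\<And>i x y. i \<in> I \<Longrightarrow> sgeq k (L i) x y \<Longrightarrow> x \<in> X i \<longleftrightarrow> y \<in> X i"
    using bchoice[OF ex] by metis
  have "finite (\<Union>i\<in>I. L i)" using assms(1) L(1) by blast
  moreover have "x \<in> (\<Union>i\<in>I. X i) \<longleftrightarrow> y \<in> (\<Union>i\<in>I. X i)" if "sgeq k (\<Union>i\<in>I. L i) x y" for x y
  proof -
    have "x \<in> X i \<longleftrightarrow> y \<in> X i" if "i \<in> I" for i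
      using L(2)[OF that] sgeq_mono[OF \<open>sgeq k (\<Union>i\<in>I. L i) x y\<close>, of "L i"] that by (simp add: UN_upper)
    then show ?thesis by simp
  qed
  ultimately show ?thesis unfolding semilin_def by blast
qed

lemma semilin_project:
  assumes "semilin (Suc k) X" shows "semilin k {x. \<exists>y. case_nat y x \<in> X}"
proof -
  obtain L where L: "finite L" "\<And>x y. sgeq (Suc k) L x y \<Longrightarrow> x \<in> X \<longleftrightarrow> y \<in> X"
    using assms unfolding semilin_def by blast
  define \<C> where "\<C> = (\<lambda>x. {y. sgeq (Suc k) L x y}) ` X"
  have "finite \<C>" unfolding \<C>_def
    by (rule finite_subset[OF _ finite_sgclasses[OF L(1)]]) (rule image_mono[OF subset_UNIV])
  moreover have "X = \<Union>\<C>"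
  proof
    show "X \<subseteq> \<Union>\<C>" using sgeq_refl by (auto simp: \<C>_def)
    show "\<Union>\<C> \<subseteq> X" using L(2) by (auto simp: \<C>_def)
  qed
  then have "{x. \<exists>y. case_nat y x \<in> X} = (\<Union>C\<in>\<C>. {x. \<exists>y. case_nat y x \<in> C})" by blast
  moreover have "semilin k {x. \<exists>y. case_nat y x \<in> C}" if "C \<in> \<C>" for C
    using that L(1) unfolding \<C>_def by (auto intro!: semilin_basic basic_project basic_sgclass)
  ultimately show ?thesis by (simp only: semilin_UN)
qed

text \<open>The tangent directions of a projection lift, because basic sets are relatively open.\<close>

lemma basic_lift_direction:
  assumes P: "basic (Suc k) P" and y: "case_nat y x \<in> P"
    and ev: "eventually (\<lambda>z. \<exists>y'. case_nat y' (\<lambda>i. x i + v i *s z) \<in> P) small"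
  shows "\<exists>u. eventually (\<lambda>z. (\<lambda>i. case_nat y x i + case_nat u v i *s z) \<in> P) small"
proof -
  obtain \<Phi> where \<Phi>: "finite \<Phi>" "P = {x. \<forall>\<phi>\<in>\<Phi>. sat (Suc k) x \<phi>}" using P unfolding basic_def by blast
  have "eventually (\<lambda>z. 0 < z \<and> (\<exists>y'. case_nat y' (\<lambda>i. x i + v i *s z) \<in> P)) small"
    using ev ev_pos by eventually_elim blast
  then obtain z0 y' where z0: "0 < z0" and y': "case_nat y' (\<lambda>i. x i + v i *s z0) \<in> P"
    using eventually_happens'[OF small_not_bot] by blast
  have eq: "l 0 *s (y' - y) + dot k (l \<circ> Suc) v *s z0 = 0" if "(True, l, c) \<in> \<Phi>" for l c
  proof -
    have "sat (Suc k) (case_nat y x) (True, l, c)" "sat (Suc k) (case_nat y' (\<lambda>i. x i + v i *s z0)) (True, l, c)"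
      using that y y' \<Phi>(2) by auto
    then show ?thesis
      unfolding sat_def by (simp add: lin_Suc_case_nat lin_move scale_right_diff)
        (metis (no_types, opaque_lifting) add.assoc add.commute add_diff_eq diff_self diff_add_eq add_diff_cancel_left')
  qed
  \<comment> \<open>The displacement \<open>y' - y\<close> lies in \<open>'r\<close>, whereas
    \<open>u\<close> has to be a scalar. An equation involving the new coordinate forces the
    displacement to be a scalar multiple of \<open>z0\<close>; if there is none,
    \<open>u = 0\<close> will do.\<close>
  obtain u where u: "\<And>l c. (True, l, c) \<in> \<Phi> \<Longrightarrow> l 0 * u + dot k (l \<circ> Suc) v = 0"
  proof (cases "\<exists>l c. (True, l, c) \<in> \<Phi> \<and> l 0 \<noteq> 0")
    case True
    then obtain l0 c0 where 0: "(True, l0, c0) \<in> \<Phi>" "l0 0 \<noteq> 0" by blast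
    define u where "u = - (inverse (l0 0) * dot k (l0 \<circ> Suc) v)"
    have "l0 0 *s (y' - y) = - (dot k (l0 \<circ> Suc) v *s z0)"
      using eq[OF 0(1)] by (simp add: eq_neg_iff_add_eq_0)
    then have "inverse (l0 0) *s l0 0 *s (y' - y) = u *s z0"
      by (simp add: u_def scale_minus_left scale_minus_right scale_scale)
    then have yu: "y' - y = u *s z0" using 0(2) by simp
    have "l 0 * u + dot k (l \<circ> Suc) v = 0" if "(True, l, c) \<in> \<Phi>" for l c
    proof -
      have "(l 0 * u + dot k (l \<circ> Suc) v) *s z0 = 0"
        using eq[OF that] by (simp add: yu scale_left_distrib scale_scale)
      then show ?thesis using z0 by (simp add: scale_eq_0)
    qed
    then show ?thesis using that by blast
  next
    case False
    then have "l 0 * 0 + dot k (l \<circ> Suc) v = 0" if "(True, l, c) \<in> \<Phi>" for l c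
      using eq[OF that] that z0 by (auto simp: scale_eq_0)
    then show ?thesis using that by blast
  qed
  have "eventually (\<lambda>z. sat (Suc k) (\<lambda>i. case_nat y x i + case_nat u v i *s z) \<phi>) small"
    if "\<phi> \<in> \<Phi>" for \<phi>
  proof -
    obtain e l c where e: "\<phi> = (e, l, c)" by (cases \<phi>)
    have s: "sat (Suc k) (case_nat y x) (e, l, c)" using that e y \<Phi>(2) by auto
    show ?thesis
    proof (cases e)
      case True
      then have "dot (Suc k) l (case_nat u v) = 0" using u that e by (simp add: lin_Suc_case_nat)
      then show ?thesis using s True unfolding e sat_def by (simp add: lin_move)
    next
      case False
      then have "0 < lin (*s) (Suc k) l (case_nat y x) - c" using s by (simp add: sat_def)
      from ev_affine_pos[OF this, of "dot (Suc k) l (case_nat u v)"] show ?thesis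
        unfolding e sat_def using False by (auto elim!: eventually_mono simp: lin_move algebra_simps)
    qed
  qed
  then have "eventually (\<lambda>z. \<forall>\<phi>\<in>\<Phi>. sat (Suc k) (\<lambda>i. case_nat y x i + case_nat u v i *s z) \<phi>) small"
    using \<Phi>(1) by (simp add: eventually_ball_finite)
  then show ?thesis using \<Phi>(2) by auto
qed

text \<open>Local constancy alone does not propagate in an order with gaps. Here changes are
  confined to the finite set \<open>B\<close>, and the induction steps over the largest point of
  \<open>B\<close> in the interval, using local constancy on both of its sides.\<close>

lemma interval_constant:
  fixes \<phi> :: "'r \<Rightarrow> bool"
  assumes "finite B" "y1 \<le> y2"
    and jump: "\<And>y y'. y1 \<le> y \<Longrightarrow> y \<le> y' \<Longrightarrow> y' \<le> y2 \<Longrightarrow> B \<inter> {y..y'} = {} \<Longrightarrow> \<phi> y = \<phi> y'"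
    and right: "\<And>y. y1 \<le> y \<Longrightarrow> y < y2 \<Longrightarrow> eventually (\<lambda>z. \<phi> (y + z) = \<phi> y) small"
    and left: "\<And>y. y1 < y \<Longrightarrow> y \<le> y2 \<Longrightarrow> eventually (\<lambda>z. \<phi> (y - z) = \<phi> y) small"
  shows "\<phi> y1 = \<phi> y2"
  using assms(2-)
proof (induction "card (B \<inter> {y1..y2})" arbitrary: y2 rule: less_induct)
  case less
  show ?case
  proof (cases "B \<inter> {y1..y2} = {}")
    case True
    then show ?thesis using less.prems(1,2) by auto
  next
    case False
    define \<beta> where "\<beta> = Max (B \<inter> {y1..y2})"
    have \<beta>: "\<beta> \<in> B \<inter> {y1..y2}" and max: "\<And>b. b \<in> B \<inter> {y1..y2} \<Longrightarrow> b \<le> \<beta>"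
      unfolding \<beta>_def using assms(1) False Max_in[of "B \<inter> {y1..y2}"] by auto
    have "\<phi> \<beta> = \<phi> y2"
    proof (cases "\<beta> = y2")
      case False
      then have "\<beta> < y2" using \<beta> by auto
      then have "eventually (\<lambda>z. \<phi> (\<beta> + z) = \<phi> \<beta>) small" "eventually (\<lambda>z. z < y2 - \<beta>) small"
        using \<beta> less.prems(3) ev_lt[of "y2 - \<beta>"] by auto
      with ev_pos have "eventually (\<lambda>z. 0 < z \<and> z < y2 - \<beta> \<and> \<phi> (\<beta> + z) = \<phi> \<beta>) small"
        by eventually_elim blast
      then obtain z where z: "0 < z" "z < y2 - \<beta>" "\<phi> (\<beta> + z) = \<phi> \<beta>"
        using eventually_happens'[OF small_not_bot] by blast
      have y: "\<beta> < \<beta> + z" "\<beta> + z \<le> y2" using z by (auto simp: less_diff_eq add.commute order.strict_implies_order)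
      have "b \<notin> B" if "b \<in> {\<beta> + z..y2}" for b
      proof
        assume "b \<in> B"
        moreover have "\<beta> < b" "b \<le> y2" using that less_le_trans[OF y(1), of b] by auto
        ultimately have "b \<le> \<beta>" using \<beta> by (intro max) auto
        then show False using \<open>\<beta> < b\<close> by simp
      qed
      then have "B \<inter> {\<beta> + z..y2} = {}" by blast
      moreover have "y1 \<le> \<beta> + z" using order.trans[of y1 \<beta> "\<beta> + z"] y \<beta> by simp
      ultimately have "\<phi> (\<beta> + z) = \<phi> y2" using y by (intro less.prems(2)) auto
      then show ?thesis using z by simp
    qed simp
    moreover have "\<phi> y1 = \<phi> \<beta>"
    proof (cases "\<beta> = y1")
      case False
      then have "y1 < \<beta>" using \<beta> by auto
      then have "eventually (\<lambda>z. \<phi> (\<beta> - z) = \<phi> \<beta>) small" "eventually (\<lambda>z. z < \<beta> - y1) small"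
        using \<beta> less.prems(4) ev_lt[of "\<beta> - y1"] by auto
      with ev_pos have "eventually (\<lambda>z. 0 < z \<and> z < \<beta> - y1 \<and> \<phi> (\<beta> - z) = \<phi> \<beta>) small"
        by eventually_elim blast
      then obtain z where z: "0 < z" "z < \<beta> - y1" "\<phi> (\<beta> - z) = \<phi> \<beta>"
        using eventually_happens'[OF small_not_bot] by blast
      have y: "\<beta> - z < \<beta>" "y1 \<le> \<beta> - z" using z by (auto simp: less_diff_eq le_diff_eq add.commute order.strict_implies_order)
      have "\<beta> - z \<le> y2" using order.trans[of "\<beta> - z" \<beta> y2] y \<beta> by simp
      then have "B \<inter> {y1..\<beta> - z} \<subseteq> B \<inter> {y1..y2}" by auto
      moreover have "\<beta> \<notin> B \<inter> {y1..\<beta> - z}" using y(1) by (auto simp: not_le)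
      ultimately have "B \<inter> {y1..\<beta> - z} \<subset> B \<inter> {y1..y2}" using \<beta> by blast
      then have "card (B \<inter> {y1..\<beta> - z}) < card (B \<inter> {y1..y2})"
        using assms(1) by (intro psubset_card_mono) auto
      then have "\<phi> y1 = \<phi> (\<beta> - z)"
        using y \<open>\<beta> - z \<le> y2\<close> less.prems
        by (intro less.hyps) (auto intro: order.trans less_le_trans)
      then show ?thesis using z by simp
    qed simp
    ultimately show ?thesis by simp
  qed
qed

lemma basic_order_convex:
  assumes "basic (Suc k) P" "case_nat y1 x \<in> P" "case_nat y2 x \<in> P" "y1 \<le> y" "y \<le> y2"
  shows "case_nat y x \<in> P"
proof -
  obtain \<Phi> where \<Phi>: "P = {x. \<forall>\<phi>\<in>\<Phi>. sat (Suc k) x \<phi>}" using assms(1) unfolding basic_def by blast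
  have "sat (Suc k) (case_nat y x) \<phi>" if "\<phi> \<in> \<Phi>" for \<phi>
  proof -
    obtain e l c where e: "\<phi> = (e, l, c)" by (cases \<phi>)
    have 12: "sat (Suc k) (case_nat y1 x) (e, l, c)" "sat (Suc k) (case_nat y2 x) (e, l, c)"
      using \<Phi> assms that e by auto
    consider "l 0 = 0" | "l 0 \<noteq> 0" e | "0 < l 0" "\<not> e" | "l 0 < 0" "\<not> e"
      using less_linear[of 0 "l 0"] by (metis (full_types))
    then show ?thesis
    proof cases
      case 1
      then show ?thesis using 12 by (cases e) (simp_all add: sat_def lin_Suc_case_nat e)
    next
      case 2
      then have "l 0 *s y1 = l 0 *s y2" using 12 by (auto simp: sat_def lin_Suc_case_nat)
      then have "y1 = y2" using 2 by (metis scale_inverse(2))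
      then have "y = y1" using assms(4,5) by simp
      then show ?thesis using 12(1) e by simp
    next
      case 3
      then show ?thesis using 12(1) assms(4) by (simp add: sat_lower e)
    next
      case 4
      then show ?thesis using 12(2) assms(5) by (simp add: sat_upper e)
    qed
  qed
  then show ?thesis using \<Phi> by blast
qed

text \<open>Along a fibre, membership in \<open>X\<close> can change only where one of the finitely
  many affine forms vanishes. At those places \<open>loc\<close> applies in the two vertical
  directions, \<open>1\<close> and \<open>- 1\<close>.\<close>

lemma basic_fibre_constant:
  assumes P: "basic (Suc k) P" and X: "semilin (Suc k) X"
    and loc: "\<And>x v. x \<in> P \<Longrightarrow> eventually (\<lambda>z. (\<lambda>i. x i + v i *s z) \<in> P) small \<Longrightarrow>
      eventually (\<lambda>z. (\<lambda>i. x i + v i *s z) \<in> X \<longleftrightarrow> x \<in> X) small"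
    and y: "case_nat y1 x \<in> P" "case_nat y2 x \<in> P" "y1 \<le> y2"
  shows "case_nat y1 x \<in> X \<longleftrightarrow> case_nat y2 x \<in> X"
proof -
  obtain L where L: "finite L" "\<And>x y. sgeq (Suc k) L x y \<Longrightarrow> x \<in> X \<longleftrightarrow> y \<in> X"
    using X unfolding semilin_def by blast
  \<comment> \<open>For \<open>l 0 = 0\<close> the value is 0, since \<open>inverse 0 = 0\<close>;
    this merely adds a harmless breakpoint.\<close>
  define root where "root = (\<lambda>(l :: nat \<Rightarrow> 'd, c). inverse (l 0) *s (c - lin (*s) k (l \<circ> Suc) x))"
  have P': "case_nat y x \<in> P" if "y1 \<le> y" "y \<le> y2" for y
    using basic_order_convex[OF P y(1,2)] that by blast
  have line: "(\<lambda>i. case_nat y x i + case_nat a (\<lambda>_. 0) i *s z) = case_nat (y + a *s z) x" for y a z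
    by (auto simp: fun_eq_iff split: nat.split)
  show ?thesis
  proof (rule interval_constant[of "root ` L"])
    fix y y' assume yy: "y1 \<le> y" "y \<le> y'" "y' \<le> y2" "root ` L \<inter> {y..y'} = {}"
    have "sgeq (Suc k) L (case_nat y x) (case_nat y' x)"
      unfolding sgeq_def
    proof (intro ballI, clarify)
      fix l c assume lc: "(l, c) \<in> L"
      define r where "r = root (l, c)"
      have r: "\<not> (y \<le> r \<and> r \<le> y')" using yy lc unfolding r_def by auto
      have s: "lin (*s) (Suc k) l (case_nat w x) - c = l 0 *s (w - r)" if "l 0 \<noteq> 0" for w
        using that by (simp add: lin_Suc_case_nat r_def root_def scale_right_diff[of "l 0"] algebra_simps)
      show "sg (lin (*s) (Suc k) l (case_nat y x) - c) = sg (lin (*s) (Suc k) l (case_nat y' x) - c)"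
      proof (cases "l 0 = 0")
        case True
        then show ?thesis by (simp add: lin_Suc_case_nat)
      next
        case False
        consider "r < y" "r < y'" | "y < r" "y' < r" using r yy(2) by (meson le_less_trans less_le_trans not_le)
        then show ?thesis
        proof cases
          case 1
          then show ?thesis using False by (simp add: s sg_scale)
        next
          case 2
          then have "sg (- (l 0) *s (r - y)) = sg (- (l 0) *s (r - y'))" by (simp add: sg_scale)
          then show ?thesis using False by (simp add: s scale_minus_left flip: scale_minus_right)
        qed
      qed
    qed
    then show "case_nat y x \<in> X \<longleftrightarrow> case_nat y' x \<in> X" by (rule L(2))
  next
    fix y assume y': "y1 \<le> y" "y < y2"
    then have "eventually (\<lambda>z. z < y2 - y) small" by (intro ev_lt) simp
    with ev_pos have "eventually (\<lambda>z. case_nat (y + 1 *s z) x \<in> P) small"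
    proof eventually_elim
      case (elim z)
      then have "y \<le> y + z" "y + z \<le> y2" by (auto simp: less_diff_eq add.commute order.strict_implies_order)
      then show ?case using y' order.trans[of y1 y "y + z"] by (intro P') (auto simp: scale_one)
    qed
    from loc[of "case_nat y x" "case_nat 1 (\<lambda>_. 0)", unfolded line, OF _ this] P' y'
    show "eventually (\<lambda>z. case_nat (y + z) x \<in> X \<longleftrightarrow> case_nat y x \<in> X) small" by (simp add: scale_one)
  next
    fix y assume y': "y1 < y" "y \<le> y2"
    then have "eventually (\<lambda>z. z < y - y1) small" by (intro ev_lt) simp
    with ev_pos have "eventually (\<lambda>z. case_nat (y + (- 1) *s z) x \<in> P) small"
    proof eventually_elim
      case (elim z)
      then have "y1 \<le> y - z" "y - z \<le> y" by (auto simp: less_diff_eq le_diff_eq add.commute order.strict_implies_order)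
      then show ?case using y' order.trans[of "y - z" y y2]
        by (intro P') (auto simp: scale_minus_left scale_one)
    qed
    from loc[of "case_nat y x" "case_nat (- 1) (\<lambda>_. 0)", unfolded line, OF _ this] P' y'
    show "eventually (\<lambda>z. case_nat (y - z) x \<in> X \<longleftrightarrow> case_nat y x \<in> X) small"
      by (simp add: scale_minus_left scale_one)
  qed (use y L in auto)
qed

text \<open>Induction on the dimension by projection. As \<open>X\<close> is constant on the fibres
  of \<open>P\<close>, it is determined by its projection, and local constancy passes to the
  projection because a direction staying in the projection of \<open>P\<close> lifts to one staying
  in \<open>P\<close>.\<close>

lemma basic_connected:
  assumes "basic k P" "semilin k X" "X \<subseteq> P"
    and "\<And>x v. x \<in> P \<Longrightarrow> eventually (\<lambda>z. (\<lambda>i. x i + v i *s z) \<in> P) small \<Longrightarrow>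
      eventually (\<lambda>z. (\<lambda>i. x i + v i *s z) \<in> X \<longleftrightarrow> x \<in> X) small"
  shows "X = {} \<or> X = P"
  using assms
proof (induction k arbitrary: P X)
  case 0
  have "sgeq 0 L x y" for L x y by (simp add: sgeq_def lin_def)
  then have "X = {} \<or> X = UNIV" using 0(2) unfolding semilin_def by blast
  then show ?case using 0(3) by auto
next
  case (Suc k)
  define P' where "P' = {x. \<exists>y. case_nat y x \<in> P}"
  define X' where "X' = {x. \<exists>y. case_nat y x \<in> X}"
  have fibre: "case_nat y1 x \<in> X \<longleftrightarrow> case_nat y2 x \<in> X"
    if "case_nat y1 x \<in> P" "case_nat y2 x \<in> P" for x y1 y2
    using basic_fibre_constant[OF Suc.prems(1,2,4), of y1 x y2]
      basic_fibre_constant[OF Suc.prems(1,2,4), of y2 x y1] that linear[of y1 y2] by blast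
  have move: "(\<lambda>i. case_nat y x i + case_nat u v i *s z) = case_nat (y + u *s z) (\<lambda>i. x i + v i *s z)"
    for y x u v z by (auto simp: fun_eq_iff split: nat.split)
  have "X' = {} \<or> X' = P'"
  proof (rule Suc.IH)
    show "basic k P'" "semilin k X'" unfolding P'_def X'_def
      using Suc.prems basic_project semilin_project by blast+
    show "X' \<subseteq> P'" using Suc.prems(3) unfolding P'_def X'_def by blast
    fix x v assume x: "x \<in> P'" and ev: "eventually (\<lambda>z. (\<lambda>i. x i + v i *s z) \<in> P') small"
    obtain y where y: "case_nat y x \<in> P" using x unfolding P'_def by blast
    obtain u where u: "eventually (\<lambda>z. (\<lambda>i. case_nat y x i + case_nat u v i *s z) \<in> P) small"
      using basic_lift_direction[OF Suc.prems(1) y, of v] ev unfolding P'_def by auto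
    show "eventually (\<lambda>z. (\<lambda>i. x i + v i *s z) \<in> X' \<longleftrightarrow> x \<in> X') small"
      using u Suc.prems(4)[OF y u]
    proof eventually_elim
      case (elim z)
      have "x \<in> X' \<longleftrightarrow> case_nat y x \<in> X" "(\<lambda>i. x i + v i *s z) \<in> X' \<longleftrightarrow> case_nat (y + u *s z) (\<lambda>i. x i + v i *s z) \<in> X"
        using fibre y elim(1) Suc.prems(3) unfolding X'_def move by blast+
      then show ?case using elim(2) by (simp add: move)
    qed
  qed
  moreover have split_0: "case_nat (x 0) (x \<circ> Suc) = x" for x :: "nat \<Rightarrow> 'r"
    by (auto simp: fun_eq_iff split: nat.split)
  ultimately show ?case
  proof (elim disjE)
    assume "X' = {}"
    then have "case_nat y x \<notin> X" for y x unfolding X'_def by blast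
    then have "x \<notin> X" for x using split_0[of x] by metis
    then show ?thesis by blast
  next
    assume "X' = P'"
    have "x \<in> X" if "x \<in> P" for x
    proof -
      note x = split_0[of x]
      then have "x \<circ> Suc \<in> P'" using that unfolding P'_def by (metis mem_Collect_eq)
      then obtain y where "case_nat y (x \<circ> Suc) \<in> X" using \<open>X' = P'\<close> unfolding X'_def by blast
      then show ?thesis using fibre[of y "x \<circ> Suc" "x 0"] that x Suc.prems(3) by auto
    qed
    then show ?thesis using Suc.prems(3) by blast
  qed
qed

end

section \<open>Germs and their periods\<close>

text \<open>The composition of covectors known from oriented matroids: the signs reached from a
  place with signs \<open>\<sigma>\<close> by a short step whose direction has signs
  \<open>\<tau>\<close>.\<close>

definition cmp :: "('i \<Rightarrow> int) \<Rightarrow> ('i \<Rightarrow> int) \<Rightarrow> 'i \<Rightarrow> int" where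
  "cmp \<sigma> \<tau> = (\<lambda>i. if \<sigma> i = 0 then \<tau> i else \<sigma> i)"

lemma cmp_assoc: "cmp (cmp \<rho> \<sigma>) \<tau> = cmp \<rho> (cmp \<sigma> \<tau>)"
  by (auto simp: cmp_def)

definition sign_vectors :: "nat \<Rightarrow> (nat \<Rightarrow> int) set" where
  "sign_vectors N = {\<sigma>. \<forall>i. (i \<in> {..<N} \<longrightarrow> \<sigma> i \<in> {- 1, 0, 1}) \<and> (i \<notin> {..<N} \<longrightarrow> \<sigma> i = 0)}"

lemma finite_sign_vectors: "finite (sign_vectors N)"
  unfolding sign_vectors_def by (intro finite_set_of_finite_funs) auto

definition (in left_ovs) sgns ::
  "nat \<Rightarrow> nat \<Rightarrow> nat \<Rightarrow> (nat \<Rightarrow> nat \<Rightarrow> 'd) \<Rightarrow> (nat \<Rightarrow> nat \<Rightarrow> 'd) \<Rightarrow> (nat \<Rightarrow> 'r) \<Rightarrow>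
   (nat \<Rightarrow> 'r) \<Rightarrow> (nat \<Rightarrow> 'r) \<Rightarrow> nat \<Rightarrow> int" where
  "sgns m n N f G c a b =
     (\<lambda>i. if i < N then sg (lin (*s) m (f i) a + lin (*s) n (G i) b - c i) else 0)"

text \<open>The parameters form the sign class of \<open>b0\<close> with respect to \<open>L\<close>, and a point \<open>a\<close> belongs to
  the set with parameter \<open>b\<close> iff \<open>Ep (sgns m n N f G c a b)\<close>.\<close>

locale piece = left_ovs scale
  for scale :: "'d::{division_ring, linordered_ring_strict} \<Rightarrow> 'r::linordered_ab_group_add \<Rightarrow> 'r"  (infixr "*s" 75) +
  fixes m n N :: nat and f G :: "nat \<Rightarrow> nat \<Rightarrow> 'd" and c :: "nat \<Rightarrow> 'r"
    and L :: "((nat \<Rightarrow> 'd) \<times> 'r) set" and b0 :: "nat \<Rightarrow> 'r" and Ep :: "(nat \<Rightarrow> int) \<Rightarrow> bool"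
  assumes finite_L: "finite L"
    and spread: "sgeq n L b0 b \<Longrightarrow> sgeq n L b0 b' \<Longrightarrow>
      \<exists>a'. sgns m n N f G c a' b' = sgns m n N f G c a b"
begin

abbreviation "H \<equiv> sgns m n N f G c"

definition Y :: "(nat \<Rightarrow> 'r) set" where "Y = {b. sgeq n L b0 b}"

text \<open>The direction space over \<open>'d\<close> of the affine hull of \<open>Y\<close>. As
  \<open>Y\<close> is open in this hull, short steps along \<open>T\<close> stay in \<open>Y\<close>
  from each of its points.\<close>

definition T :: "(nat \<Rightarrow> 'd) set" where
  "T = {v. \<forall>(l, e)\<in>L. lin (*s) n l b0 = e \<longrightarrow> dot n l v = 0}"

definition dsg :: "(nat \<Rightarrow> 'd) \<Rightarrow> nat \<Rightarrow> int" where
  "dsg v = (\<lambda>i. if i < N then sg (dot n (G i) v) else 0)"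

text \<open>If \<open>\<sigma> = H a b\<close>, then \<open>germ \<sigma> v\<close> says whether \<open>a\<close> belongs to the sets with parameter
  \<open>b + v z\<close> for all small \<open>z > 0\<close>.\<close>

definition germ :: "(nat \<Rightarrow> int) \<Rightarrow> (nat \<Rightarrow> 'd) \<Rightarrow> bool" where
  "germ \<sigma> v = Ep (cmp \<sigma> (dsg v))"

text \<open>The condition compares the germ at \<open>b\<close> with the germ a short step along
  \<open>v\<close> away, in terms of sign vectors. That this amounts to invariance of the germ under
  translation by \<open>v\<close> is \<open>W_iff\<close>.\<close>

definition W :: "(nat \<Rightarrow> int) \<Rightarrow> (nat \<Rightarrow> 'd) set" where
  "W \<sigma> = {v \<in> T. \<forall>u\<in>T. germ (cmp \<sigma> (dsg v)) u = germ \<sigma> u}"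

lemma T_lin: "u \<in> T \<Longrightarrow> v \<in> T \<Longrightarrow> (\<lambda>i. u i + v i * e) \<in> T"
  unfolding T_def by (fastforce simp: self.lin_add self.lin_scale_right)

lemma T_zero: "(\<lambda>_. 0) \<in> T"
  unfolding T_def by auto

lemma T_scale: "v \<in> T \<Longrightarrow> (\<lambda>i. v i * e) \<in> T"
  using T_lin[OF T_zero, of v e] by simp

lemma T_add: "u \<in> T \<Longrightarrow> v \<in> T \<Longrightarrow> (\<lambda>i. u i + v i) \<in> T"
  using T_lin[of u v 1] by simp

lemma T_minus: "v \<in> T \<Longrightarrow> (\<lambda>i. - v i) \<in> T"
  using T_scale[of v "- 1"] by simp

lemma dsg_scale: "0 < e \<Longrightarrow> dsg (\<lambda>i. v i * e) = dsg v"
  by (simp add: dsg_def self.lin_scale_right self.sg_scale cong: if_cong)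

lemma dsg_move: "eventually (\<lambda>e. dsg (\<lambda>i. u i + v i * e) = cmp (dsg u) (dsg v)) small"
proof -
  have "eventually (\<lambda>e. \<forall>i\<in>{..<N}. sg (dot n (G i) (\<lambda>i. u i + v i * e) - 0)
    = (if dot n (G i) u = 0 then sg (dot n (G i) v) else sg (dot n (G i) u - 0))) small"
    by (intro eventually_ball_finite ballI self.ev_sg_lin) simp
  then show ?thesis
    by (rule eventually_mono) (auto simp: dsg_def cmp_def fun_eq_iff)
qed

lemma sgns_move:
  "eventually (\<lambda>z. H (\<lambda>i. a i + \<mu> i *s z) (\<lambda>i. b i + v i *s z) =
     cmp (H a b) (\<lambda>i. if i < N then sg (dot m (f i) \<mu> + dot n (G i) v) else 0)) small"
proof -
  define p where "p i = lin (*s) m (f i) a + lin (*s) n (G i) b - c i" for i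
  define q where "q i = dot m (f i) \<mu> + dot n (G i) v" for i
  have "eventually (\<lambda>z. \<forall>i\<in>{..<N}. sg (p i + q i *s z) = (if p i = 0 then sg (q i) else sg (p i))) small"
    by (intro eventually_ball_finite ballI ev_sg) simp
  then show ?thesis
  proof (rule eventually_mono)
    fix z assume z: "\<forall>i\<in>{..<N}. sg (p i + q i *s z) = (if p i = 0 then sg (q i) else sg (p i))"
    have e: "lin (*s) m (f i) (\<lambda>i. a i + \<mu> i *s z) + lin (*s) n (G i) (\<lambda>i. b i + v i *s z) - c i
      = p i + q i *s z" for i
      by (simp add: lin_move scale_left_distrib p_def q_def algebra_simps)
    show "H (\<lambda>i. a i + \<mu> i *s z) (\<lambda>i. b i + v i *s z) =
     cmp (H a b) (\<lambda>i. if i < N then sg (dot m (f i) \<mu> + dot n (G i) v) else 0)"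
      unfolding sgns_def cmp_def e p_def[symmetric] q_def[symmetric]
    proof (rule ext)
      fix i show "(if i < N then sg (p i + q i *s z) else 0) =
        (if (if i < N then sg (p i) else 0) = 0 then if i < N then sg (q i) else 0
         else if i < N then sg (p i) else 0)"
        using bspec[OF z, of i] by (cases "i < N"; cases "p i = 0") simp_all
    qed
  qed
qed

lemma sgns_move_param: "eventually (\<lambda>z. H a (\<lambda>i. b i + v i *s z) = cmp (H a b) (dsg v)) small"
  using sgns_move[of a "\<lambda>_. 0" b v] by (simp add: dsg_def cong: if_cong)

lemma b0_in_Y: "b0 \<in> Y"
  by (simp add: Y_def sgeq_refl)

lemma Y_eq:
  assumes "b \<in> Y" "(l, e) \<in> L" shows "lin (*s) n l b = e \<longleftrightarrow> lin (*s) n l b0 = e"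
proof -
  have "sg (lin (*s) n l b0 - e) = sg (lin (*s) n l b - e)"
    using assms unfolding Y_def sgeq_def by blast
  then show ?thesis by (metis eq_iff_diff_eq_0 sg_eq_0_iff)
qed

lemma Y_move:
  assumes "b \<in> Y" "v \<in> T" shows "eventually (\<lambda>z. (\<lambda>i. b i + v i *s z) \<in> Y) small"
proof -
  have "eventually (\<lambda>z. \<forall>p\<in>L. sg (lin (*s) n (fst p) (\<lambda>i. b i + v i *s z) - snd p) =
     (if lin (*s) n (fst p) b = snd p then sg (dot n (fst p) v) else sg (lin (*s) n (fst p) b - snd p))) small"
    by (intro eventually_ball_finite ballI ev_sg_lin finite_L)
  then show ?thesis
  proof (rule eventually_mono)
    fix z assume z: "\<forall>p\<in>L. sg (lin (*s) n (fst p) (\<lambda>i. b i + v i *s z) - snd p) =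
     (if lin (*s) n (fst p) b = snd p then sg (dot n (fst p) v) else sg (lin (*s) n (fst p) b - snd p))"
    have "sgeq n L b (\<lambda>i. b i + v i *s z)"
      unfolding sgeq_def
    proof (intro ballI, clarify)
      fix l e assume le: "(l, e) \<in> L"
      then have "lin (*s) n l b = e \<Longrightarrow> dot n l v = 0"
        using Y_eq[OF assms(1) le] assms(2) unfolding T_def by auto
      then show "sg (lin (*s) n l b - e) = sg (lin (*s) n l (\<lambda>i. b i + v i *s z) - e)"
        using z le by force
    qed
    then show "(\<lambda>i. b i + v i *s z) \<in> Y" using assms(1) sgeq_trans unfolding Y_def by blast
  qed
qed

lemma T_if_Y_move:
  assumes "b \<in> Y" "(\<lambda>i. b i + v i *s z) \<in> Y" "0 < z" shows "v \<in> T"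
  unfolding T_def
proof (intro CollectI ballI, clarify)
  fix l assume l: "(l, lin (*s) n l b0) \<in> L"
  have "lin (*s) n l b = lin (*s) n l b0" "lin (*s) n l (\<lambda>i. b i + v i *s z) = lin (*s) n l b0"
    using Y_eq[OF _ l] assms by auto
  then show "dot n l v = 0" using assms(3) by (simp add: lin_move scale_eq_0)
qed

lemma germ_zero: "germ \<sigma> (\<lambda>_. 0) = Ep \<sigma>"
  unfolding germ_def by (rule arg_cong[of _ _ Ep]) (auto simp: dsg_def cmp_def fun_eq_iff)

lemma germ_scale: "0 < e \<Longrightarrow> germ \<sigma> (\<lambda>i. v i * e) = germ \<sigma> v"
  by (simp add: germ_def dsg_scale)

lemma germ_move: "eventually (\<lambda>e. \<forall>\<sigma>. germ \<sigma> (\<lambda>i. v i + u i * e) = germ (cmp \<sigma> (dsg v)) u) small"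
  using dsg_move[of v u] by (rule eventually_mono) (simp add: germ_def cmp_assoc)

text \<open>Far away along \<open>v\<close> the germ is the germ of \<open>cmp \<sigma> (dsg v)\<close>, both seen from \<open>u\<close> and from
  \<open>u + v\<close>.\<close>

lemma W_period:
  assumes v: "v \<in> W \<sigma>" and u: "u \<in> T"
  shows "germ \<sigma> (\<lambda>i. u i + v i) = germ \<sigma> u"
proof -
  define w where "w = (\<lambda>i. u i + v i)"
  have vT: "v \<in> T" using v unfolding W_def by blast
  then have w: "w \<in> T" using u T_add by (simp add: w_def)
  have ev: "eventually (\<lambda>e. germ \<sigma> (\<lambda>i. v i + x i * e) = germ \<sigma> x) small" if "x \<in> T" for x
    using germ_move[of v x] by (rule eventually_mono) (use v that in \<open>auto simp: W_def\<close>)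
  from ev[OF u] obtain d where d: "0 < d" "\<And>e. 0 < e \<Longrightarrow> e < d \<Longrightarrow> germ \<sigma> (\<lambda>i. v i + u i * e) = germ \<sigma> u"
    unfolding self.eventually_small by blast
  have "eventually (\<lambda>e. 0 < e \<and> e < d \<and> germ \<sigma> (\<lambda>i. v i + w i * e) = germ \<sigma> w) small"
    using self.ev_pos self.ev_lt[OF d(1)] ev[OF w] by eventually_elim blast
  then obtain e where e: "0 < e" "e < d" "germ \<sigma> (\<lambda>i. v i + w i * e) = germ \<sigma> w"
    using eventually_happens'[OF self.small_not_bot] by blast
  \<comment> \<open>With this value \<open>v + u t\<close>, scaled by \<open>1 + e\<close>, equals
    \<open>v + (u + v) e\<close>: the two far points lie on one ray and have the same germ value.
    Moreover \<open>t < e\<close>, so \<open>t\<close> is still below the threshold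
    \<open>d\<close>.\<close>
  define t where "t = e * inverse (1 + e)"
  have e1: "0 < 1 + e" using e(1) zero_less_one_ring by (rule add_pos_pos[rotated])
  then have t0: "0 < t" unfolding t_def by (intro mult_pos_pos e pos_inverse)
  have "1 + e \<noteq> 0" using e1 by (metis less_irrefl)
  then have te: "t * (1 + e) = e" by (simp add: t_def mult.assoc)
  have "t < t + t * e" using t0 e(1) by simp
  also have "\<dots> = e" using te by (simp add: distrib_left)
  finally have "t < d" using e(2) by (rule less_trans)
  then have 1: "germ \<sigma> (\<lambda>i. v i + u i * t) = germ \<sigma> u" using d t0 by blast
  have "(v i + u i * t) * (1 + e) = v i + w i * e" for i
  proof -
    have "(v i + u i * t) * (1 + e) = v i * (1 + e) + u i * (t * (1 + e))"
      by (simp only: distrib_right mult.assoc)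
    then show ?thesis unfolding te by (simp add: w_def algebra_simps)
  qed
  then have "germ \<sigma> (\<lambda>i. v i + w i * e) = germ \<sigma> (\<lambda>i. v i + u i * t)"
    using germ_scale[OF e1, of \<sigma> "\<lambda>i. v i + u i * t"] by simp
  then show ?thesis using 1 e(3) by (simp add: w_def)
qed

lemma W_iff: "v \<in> W \<sigma> \<longleftrightarrow> v \<in> T \<and> (\<forall>u\<in>T. germ \<sigma> (\<lambda>i. u i + v i) = germ \<sigma> u)"
proof
  assume r: "v \<in> T \<and> (\<forall>u\<in>T. germ \<sigma> (\<lambda>i. u i + v i) = germ \<sigma> u)"
  have "germ (cmp \<sigma> (dsg v)) u = germ \<sigma> u" if u: "u \<in> T" for u
  proof -
    have "eventually (\<lambda>e. 0 < e \<and> germ \<sigma> (\<lambda>i. v i + u i * e) = germ (cmp \<sigma> (dsg v)) u) small"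
      using self.ev_pos germ_move[of v u] by eventually_elim blast
    then obtain e where e: "0 < e" "germ \<sigma> (\<lambda>i. v i + u i * e) = germ (cmp \<sigma> (dsg v)) u"
      using eventually_happens'[OF self.small_not_bot] by blast
    have "germ (cmp \<sigma> (dsg v)) u = germ \<sigma> (\<lambda>i. u i * e + v i)"
      unfolding e(2)[symmetric] by (simp only: add.commute)
    also have "\<dots> = germ \<sigma> (\<lambda>i. u i * e)"
      by (rule r[THEN conjunct2, THEN bspec, OF T_scale[OF u]])
    also have "\<dots> = germ \<sigma> u" by (rule germ_scale[OF e(1)])
    finally show ?thesis .
  qed
  then show "v \<in> W \<sigma>" using r unfolding W_def by blast
qed (use W_period W_def in auto)

section \<open>The space of periods and its linear equations\<close>

lemma W_zero: "(\<lambda>_. 0) \<in> W \<sigma>"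
  unfolding W_iff by (simp add: T_zero)

lemma W_add: "v \<in> W \<sigma> \<Longrightarrow> w \<in> W \<sigma> \<Longrightarrow> (\<lambda>i. v i + w i) \<in> W \<sigma>"
  unfolding W_iff using T_add by (auto simp flip: add.assoc)

lemma W_diff:
  assumes v: "v \<in> W \<sigma>" and w: "(\<lambda>i. v i + w i) \<in> W \<sigma>" shows "w \<in> W \<sigma>"
proof -
  have T: "v \<in> T" "(\<lambda>i. v i + w i) \<in> T" using v w unfolding W_iff by blast+
  then have wT: "w \<in> T" using T_add[OF T_minus[OF T(1)] T(2)] by simp
  have "germ \<sigma> (\<lambda>i. u i + w i) = germ \<sigma> u" if u: "u \<in> T" for u
  proof -
    have "germ \<sigma> (\<lambda>i. (u i + w i) + v i) = germ \<sigma> (\<lambda>i. u i + w i)"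
      using W_period[OF v T_add[OF u wT]] .
    moreover have "germ \<sigma> (\<lambda>i. u i + (v i + w i)) = germ \<sigma> u" using W_period[OF w u] .
    ultimately show ?thesis by (simp add: algebra_simps)
  qed
  then show ?thesis using wT unfolding W_iff by blast
qed

lemma W_scale:
  assumes v: "v \<in> W \<sigma>" and e: "0 < e" shows "(\<lambda>i. v i * e) \<in> W \<sigma>"
proof -
  have vT: "v \<in> T" using v unfolding W_def by blast
  have e0: "e \<noteq> 0" using e by blast
  have "germ \<sigma> (\<lambda>i. u i + v i * e) = germ \<sigma> u" if u: "u \<in> T" for u
  proof -
    have "germ \<sigma> (\<lambda>i. u i + v i * e) = germ \<sigma> (\<lambda>i. (u i * inverse e + v i) * e)"
      using e0 by (simp add: distrib_right mult.assoc)
    also have "\<dots> = germ \<sigma> (\<lambda>i. u i * inverse e + v i)" using germ_scale[OF e] .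
    also have "\<dots> = germ \<sigma> (\<lambda>i. u i * inverse e)" using W_period[OF v T_scale[OF u]] .
    also have "\<dots> = germ \<sigma> u" using germ_scale[OF pos_inverse[OF e]] .
    finally show ?thesis .
  qed
  then show ?thesis using T_scale[OF vT] unfolding W_iff by blast
qed

lemma W_scale_iff: "0 < e \<Longrightarrow> (\<lambda>i. v i * e) \<in> W \<sigma> \<longleftrightarrow> v \<in> W \<sigma>"
proof
  assume e: "0 < e" and v: "(\<lambda>i. v i * e) \<in> W \<sigma>"
  have "e \<noteq> 0" using e by blast
  then show "v \<in> W \<sigma>" using W_scale[OF v pos_inverse[OF e]] by (simp add: mult.assoc)
qed (rule W_scale)

lemma W_of_nat: "v \<in> W \<sigma> \<Longrightarrow> (\<lambda>i. v i * of_nat k) \<in> W \<sigma>"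
proof (induction k)
  case (Suc k)
  then show ?case using W_add[of v \<sigma> "\<lambda>i. v i * of_nat k"] by (simp add: distrib_left)
qed (simp add: W_zero)

text \<open>A vector of \<open>W \<sigma>\<close> lying on as few of the hyperplanes as possible lies only on those that
  contain \<open>W \<sigma>\<close>.\<close>

lemma W_kernel:
  "\<exists>J \<subseteq> {i. i < N \<and> \<sigma> i = 0}. W \<sigma> = {v \<in> T. \<forall>j\<in>J. dot n (G j) v = 0}"
proof -
  define Z where "Z v = {i. i < N \<and> \<sigma> i = 0 \<and> dot n (G i) v = 0}" for v
  have finZ: "finite (Z v)" for v by (simp add: Z_def)
  obtain v where v: "v \<in> W \<sigma>" "\<And>w. w \<in> W \<sigma> \<Longrightarrow> card (Z v) \<le> card (Z w)"
    using ex_has_least_nat[of "\<lambda>v. v \<in> W \<sigma>" "\<lambda>_. 0" "\<lambda>v. card (Z v)"] W_zero by blast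
  have vT: "v \<in> T" using v(1) unfolding W_def by blast
  have gen: "\<exists>e>0. dsg (\<lambda>i. v i + w i * e) = cmp (dsg v) (dsg w)" for w
  proof -
    have "eventually (\<lambda>e. 0 < e \<and> dsg (\<lambda>i. v i + w i * e) = cmp (dsg v) (dsg w)) small"
      using self.ev_pos dsg_move[of v w] by eventually_elim blast
    then show ?thesis using eventually_happens'[OF self.small_not_bot] by blast
  qed
  have "W \<sigma> = {w \<in> T. \<forall>j\<in>Z v. dot n (G j) w = 0}"
  proof (intro set_eqI iffI)
    fix w assume w: "w \<in> W \<sigma>"
    obtain e where e: "0 < e" "dsg (\<lambda>i. v i + w i * e) = cmp (dsg v) (dsg w)" using gen by blast
    define x where "x = (\<lambda>i. v i + w i * e)"
    have "x \<in> W \<sigma>" unfolding x_def using W_add[OF v(1) W_scale[OF w e(1)]] .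
    moreover have Zx: "Z x = Z v \<inter> Z w"
    proof -
      have "dot n (G i) x = 0 \<longleftrightarrow> dot n (G i) v = 0 \<and> dot n (G i) w = 0" if "i < N" for i
        using fun_cong[OF e(2), of i] that by (auto simp: dsg_def cmp_def x_def split: if_splits)
      then show ?thesis by (auto simp: Z_def)
    qed
    ultimately have "Z x = Z v" using v(2) finZ by (metis Int_lower1 card_seteq)
    then have "Z v \<subseteq> Z w" using Zx by blast
    then show "w \<in> {w \<in> T. \<forall>j\<in>Z v. dot n (G j) w = 0}" using w by (auto simp: Z_def W_def)
  next
    fix w assume w: "w \<in> {w \<in> T. \<forall>j\<in>Z v. dot n (G j) w = 0}"
    obtain e where e: "0 < e" "dsg (\<lambda>i. v i + w i * e) = cmp (dsg v) (dsg w)" using gen by blast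
    \<comment> \<open>Where \<open>\<sigma>\<close> vanishes, the sign of \<open>v\<close> prevails
      outside \<open>Z v\<close>, and \<open>w\<close> vanishes on \<open>Z v\<close>.\<close>
    have "cmp \<sigma> (cmp (dsg v) (dsg w)) = cmp \<sigma> (dsg v)"
      using w by (auto simp: cmp_def dsg_def Z_def fun_eq_iff)
    then have "cmp \<sigma> (dsg (\<lambda>i. v i + w i * e)) = cmp \<sigma> (dsg v)" using e by simp
    moreover have "(\<lambda>i. v i + w i * e) \<in> T" using w vT T_lin by blast
    ultimately have "(\<lambda>i. v i + w i * e) \<in> W \<sigma>" using v(1) unfolding W_def by simp
    from W_diff[OF v(1) this] show "w \<in> W \<sigma>" by (simp only: W_scale_iff[OF e(1)])
  qed
  moreover have "Z v \<subseteq> {i. i < N \<and> \<sigma> i = 0}" by (auto simp: Z_def)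
  ultimately show ?thesis by blast
qed

text \<open>That \<open>\<sigma>\<close> vanishes on these indices is essential for the encoding: if
  \<open>H a b = \<sigma>\<close>, then \<open>a\<close> alone fixes the value of each form
  \<open>G j\<close> with \<open>j \<in> J \<sigma>\<close> at \<open>b\<close>.\<close>

definition J :: "(nat \<Rightarrow> int) \<Rightarrow> nat set" where
  "J \<sigma> = (SOME J. J \<subseteq> {i. i < N \<and> \<sigma> i = 0} \<and> W \<sigma> = {v \<in> T. \<forall>j\<in>J. dot n (G j) v = 0})"

lemma J: "J \<sigma> \<subseteq> {i. i < N \<and> \<sigma> i = 0}" "W \<sigma> = {v \<in> T. \<forall>j\<in>J \<sigma>. dot n (G j) v = 0}"
  using someI_ex[OF W_kernel[of \<sigma>]] unfolding J_def by blast+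

section \<open>Irredundant families of sign vectors and the exponent\<close>

definition WW :: "(nat \<Rightarrow> int) set \<Rightarrow> (nat \<Rightarrow> 'd) set" where
  "WW \<Delta> = {v \<in> T. \<forall>\<sigma>\<in>\<Delta>. v \<in> W \<sigma>}"

definition irr :: "(nat \<Rightarrow> int) set \<Rightarrow> bool" where
  "irr \<Delta> \<longleftrightarrow> (\<forall>\<sigma>\<in>\<Delta>. WW \<Delta> \<noteq> WW (\<Delta> - {\<sigma>}))"

text \<open>By \<open>spread\<close> every other parameter in \<open>Y\<close> yields the same set,
  so the exponent belongs to the whole piece.\<close>

definition Sig :: "(nat \<Rightarrow> int) set" where "Sig = range (\<lambda>a. H a b0)"

definition rank :: nat where "rank = Max (card ` {\<Delta>. \<Delta> \<subseteq> Sig \<and> irr \<Delta>})"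

lemma sgns_in: "H a b \<in> sign_vectors N" and dsg_in: "dsg v \<in> sign_vectors N"
  using sg_range[where 'a = 'r] sg_range[where 'a = 'd]
  by (auto simp: sign_vectors_def sgns_def dsg_def simp del: insert_iff)

lemma finite_Sig: "finite Sig"
  by (rule finite_subset[OF _ finite_sign_vectors]) (use sgns_in in \<open>auto simp: Sig_def\<close>)

lemma sgns_Sig: "b \<in> Y \<Longrightarrow> H a b \<in> Sig"
  using spread[of b b0 a] unfolding Y_def Sig_def by (metis mem_Collect_eq rangeI sgeq_refl)

lemma irr_witness:
  assumes "irr \<Delta>"
  obtains v where "\<And>\<sigma>. \<sigma> \<in> \<Delta> \<Longrightarrow> v \<sigma> \<in> WW (\<Delta> - {\<sigma>})" "\<And>\<sigma>. \<sigma> \<in> \<Delta> \<Longrightarrow> v \<sigma> \<notin> W \<sigma>"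
proof -
  have "\<exists>v. v \<in> WW (\<Delta> - {\<sigma>}) \<and> v \<notin> W \<sigma>" if "\<sigma> \<in> \<Delta>" for \<sigma>
    using assms that unfolding irr_def WW_def by blast
  then show ?thesis using that by metis
qed

text \<open>A witness \<open>v \<sigma>\<close> lies in the period spaces of all the other members
  but not in that of \<open>\<sigma>\<close>. Hence some form of \<open>J \<sigma>\<close> is
  nonzero at it and kills all other witnesses, which gives a dual system.\<close>

lemma irr_card_le:
  assumes "irr \<Delta>" "finite \<Delta>" shows "card \<Delta> \<le> n"
proof -
  obtain v where v: "\<And>\<sigma>. \<sigma> \<in> \<Delta> \<Longrightarrow> v \<sigma> \<in> WW (\<Delta> - {\<sigma>})" "\<And>\<sigma>. \<sigma> \<in> \<Delta> \<Longrightarrow> v \<sigma> \<notin> W \<sigma>"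
    using irr_witness[OF assms(1)] by blast
  have "\<exists>j\<in>J \<sigma>. dot n (G j) (v \<sigma>) \<noteq> 0" if "\<sigma> \<in> \<Delta>" for \<sigma>
    using v[OF that] J(2)[of \<sigma>] unfolding WW_def by blast
  then obtain j where j: "\<And>\<sigma>. \<sigma> \<in> \<Delta> \<Longrightarrow> j \<sigma> \<in> J \<sigma>" "\<And>\<sigma>. \<sigma> \<in> \<Delta> \<Longrightarrow> dot n (G (j \<sigma>)) (v \<sigma>) \<noteq> 0"
    by metis
  have "dot n (G (j \<sigma>)) (v \<tau>) = 0" if "\<sigma> \<in> \<Delta>" "\<tau> \<in> \<Delta>" "\<sigma> \<noteq> \<tau>" for \<sigma> \<tau>
  proof -
    have "v \<tau> \<in> W \<sigma>" using v(1)[OF that(2)] that unfolding WW_def by blast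
    then show ?thesis using j(1)[OF that(1)] J(2)[of \<sigma>] by blast
  qed
  then show ?thesis using j(2) assms(2) by (intro card_le_dim[of _ _ "\<lambda>\<sigma>. G (j \<sigma>)" v]) auto
qed

lemma irr_rank:
  shows "\<exists>\<Delta>. \<Delta> \<subseteq> Sig \<and> irr \<Delta> \<and> card \<Delta> = rank" and "\<Delta> \<subseteq> Sig \<Longrightarrow> irr \<Delta> \<Longrightarrow> card \<Delta> \<le> rank"
proof -
  let ?C = "card ` {\<Delta>. \<Delta> \<subseteq> Sig \<and> irr \<Delta>}"
  have fin: "finite ?C" using finite_Sig by simp
  have "irr {}" by (simp add: irr_def)
  then have "?C \<noteq> {}" by blast
  then have "rank \<in> ?C" unfolding rank_def using fin by (intro Max_in)
  then show "\<exists>\<Delta>. \<Delta> \<subseteq> Sig \<and> irr \<Delta> \<and> card \<Delta> = rank" by auto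
  show "\<Delta> \<subseteq> Sig \<Longrightarrow> irr \<Delta> \<Longrightarrow> card \<Delta> \<le> rank"
    unfolding rank_def using fin by (intro Max_ge) auto
qed

lemma rank_le: "rank \<le> n"
  using irr_rank(1) irr_card_le finite_Sig finite_subset by metis

end

section \<open>The upper bound on a piece\<close>

context piece
begin

lemma WW_I: "v \<in> T \<Longrightarrow> (\<And>\<sigma>. \<sigma> \<in> \<Delta> \<Longrightarrow> v \<in> W \<sigma>) \<Longrightarrow> v \<in> WW \<Delta>"
  and WW_T: "v \<in> WW \<Delta> \<Longrightarrow> v \<in> T" and WW_D: "v \<in> WW \<Delta> \<Longrightarrow> \<sigma> \<in> \<Delta> \<Longrightarrow> v \<in> W \<sigma>"
  unfolding WW_def by blast+

text \<open>A substitute for the dimension: a vector lost in a strict inclusion of common period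
  spaces is detected by a form of some \<open>J \<sigma>\<close> that vanishes on the smaller
  space.\<close>

definition meas :: "(nat \<Rightarrow> 'd) set \<Rightarrow> nat" where
  "meas V = card {i. i < N \<and> (\<exists>v\<in>V. dot n (G i) v \<noteq> 0)}"

lemma meas_less:
  assumes "WW \<Delta>' \<subset> WW \<Delta>" shows "meas (WW \<Delta>') < meas (WW \<Delta>)"
proof -
  obtain v where v: "v \<in> WW \<Delta>" "v \<notin> WW \<Delta>'" using assms by blast
  then obtain \<sigma> where s: "\<sigma> \<in> \<Delta>'" "v \<notin> W \<sigma>" unfolding WW_def by blast
  then obtain j where j: "j \<in> J \<sigma>" "dot n (G j) v \<noteq> 0" using v(1) WW_T J(2)[of \<sigma>] by blast
  have "j < N" using j J(1) by blast
  have "dot n (G j) w = 0" if "w \<in> WW \<Delta>'" for w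
    using WW_D[OF that s(1)] j(1) J(2)[of \<sigma>] by blast
  then have "{i. i < N \<and> (\<exists>v\<in>WW \<Delta>'. dot n (G i) v \<noteq> 0)} \<subset> {i. i < N \<and> (\<exists>v\<in>WW \<Delta>. dot n (G i) v \<noteq> 0)}"
    using assms j v(1) \<open>j < N\<close> by blast
  then show ?thesis unfolding meas_def by (intro psubset_card_mono) auto
qed

text \<open>The set \<open>X\<close> is the trace of the points \<open>b + u z\<close> for all small \<open>z > 0\<close>.\<close>

definition touches :: "'z set \<Rightarrow> ('z \<Rightarrow> nat \<Rightarrow> 'r) \<Rightarrow> 'z set \<Rightarrow> (nat \<Rightarrow> 'r) \<Rightarrow> (nat \<Rightarrow> 'd) \<Rightarrow> bool" where
  "touches A p X b u \<longleftrightarrow> b \<in> Y \<and> u \<in> T \<and> X = {a \<in> A. germ (H (p a) b) u}"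

definition periods :: "'z set \<Rightarrow> ('z \<Rightarrow> nat \<Rightarrow> 'r) \<Rightarrow> (nat \<Rightarrow> 'r) \<Rightarrow> (nat \<Rightarrow> 'd) set" where
  "periods A p b = WW ((\<lambda>a. H (p a) b) ` A)"

definition same_germs :: "'z set \<Rightarrow> ('z \<Rightarrow> nat \<Rightarrow> 'r) \<Rightarrow> (nat \<Rightarrow> 'r) \<Rightarrow> (nat \<Rightarrow> 'r) \<Rightarrow> bool" where
  "same_germs A p b b' \<longleftrightarrow> (\<forall>a\<in>A. \<forall>w\<in>T. germ (H (p a) b') w = germ (H (p a) b) w)"

text \<open>The part of \<open>Y\<close> in the affine space over \<open>'r\<close> through
  \<open>b\<close> with directions \<open>periods A p b\<close>. Equations describe it because the
  difference of two of its points need not be a vector over \<open>'d\<close> times one element of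
  \<open>'r\<close>.\<close>

definition flat :: "'z set \<Rightarrow> ('z \<Rightarrow> nat \<Rightarrow> 'r) \<Rightarrow> (nat \<Rightarrow> 'r) \<Rightarrow> (nat \<Rightarrow> 'r) set" where
  "flat A p b = {b' \<in> Y. \<forall>a\<in>A. \<forall>i\<in>J (H (p a) b). lin (*s) n (G i) b' = lin (*s) n (G i) b}"

lemma periods_iff: "v \<in> periods A p b \<longleftrightarrow> v \<in> T \<and> (\<forall>a\<in>A. v \<in> W (H (p a) b))"
  unfolding periods_def WW_def by blast

lemma W_cong:
  assumes "\<And>w. w \<in> T \<Longrightarrow> germ \<sigma> w = germ \<tau> w" shows "W \<sigma> = W \<tau>"
  using assms T_add unfolding set_eq_iff W_iff by blast

lemma W_germ: "v \<in> W \<sigma> \<Longrightarrow> u \<in> T \<Longrightarrow> germ (cmp \<sigma> (dsg v)) u = germ \<sigma> u"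
  unfolding W_def by blast

text \<open>Moving off a point \<open>x\<close> in a direction which changes the germs back to those of \<open>b\<close>
  exhibits \<open>x\<close> as a touching point with fewer periods.\<close>

lemma periods_decrease:
  assumes returns: "\<And>a w. a \<in> A \<Longrightarrow> w \<in> T \<Longrightarrow> germ (cmp (H (p a) x) (dsg v)) w = germ (H (p a) b) w"
    and v: "v \<in> periods A p b" and x: "\<not> same_germs A p b x"
  shows "periods A p x \<subset> periods A p b"
proof
  have vT: "v \<in> T" using v unfolding periods_iff by blast
  show "periods A p x \<subseteq> periods A p b"
  proof
    fix w assume w: "w \<in> periods A p x"
    then have wT: "w \<in> T" unfolding periods_iff by blast
    have "w \<in> W (H (p a) b)" if a: "a \<in> A" for a
    proof -
      let ?\<sigma> = "H (p a) x"
      have W: "w \<in> W ?\<sigma>" using w a unfolding periods_iff by blast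
      have "germ (H (p a) b) (\<lambda>i. u i + w i) = germ (H (p a) b) u" if u: "u \<in> T" for u
      proof -
        have "eventually (\<lambda>e. 0 < e \<and>
            germ ?\<sigma> (\<lambda>i. v i + (u i + w i) * e) = germ (cmp ?\<sigma> (dsg v)) (\<lambda>i. u i + w i) \<and>
            germ ?\<sigma> (\<lambda>i. v i + u i * e) = germ (cmp ?\<sigma> (dsg v)) u) small"
          using self.ev_pos germ_move[of v "\<lambda>i. u i + w i"] germ_move[of v u]
          by eventually_elim blast
        then obtain e where e: "0 < e"
            "germ ?\<sigma> (\<lambda>i. v i + (u i + w i) * e) = germ (cmp ?\<sigma> (dsg v)) (\<lambda>i. u i + w i)"
            "germ ?\<sigma> (\<lambda>i. v i + u i * e) = germ (cmp ?\<sigma> (dsg v)) u"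
          using eventually_happens'[OF self.small_not_bot] by blast
        have "germ ?\<sigma> (\<lambda>i. (v i + u i * e) + w i * e) = germ ?\<sigma> (\<lambda>i. v i + u i * e)"
          using W_period[OF W_scale[OF W e(1)] T_lin[OF vT u]] .
        then have "germ (cmp ?\<sigma> (dsg v)) (\<lambda>i. u i + w i) = germ (cmp ?\<sigma> (dsg v)) u"
          unfolding e(2,3)[symmetric] by (simp only: distrib_right add.assoc)
        then show ?thesis using returns[OF a] u T_add[OF u wT] by simp
      qed
      then show ?thesis using wT unfolding W_iff by blast
    qed
    then show "w \<in> periods A p b" using wT unfolding periods_iff by blast
  qed
  have "v \<notin> periods A p x"
  proof
    assume "v \<in> periods A p x"
    then have "germ (H (p a) b) w = germ (H (p a) x) w" if "a \<in> A" "w \<in> T" for a w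
      using returns[OF that] W_germ[OF _ that(2)] that(1) unfolding periods_iff by metis
    then show False using x unfolding same_germs_def by metis
  qed
  then show "periods A p x \<noteq> periods A p b" using v by blast
qed

text \<open>The points of the flat having the germs of \<open>b\<close> form a set that no short
  step can leave or enter. It cannot be left because every direction of the flat is a period there,
  \<open>W\<close> depending on germs only. A step entering it from \<open>x\<close> would make
  \<open>x\<close> a touching point with fewer periods, against minimality. Connectedness of the
  flat does the rest.\<close>

lemma minimal_same_germs:
  assumes A: "finite A" and t: "touches A p X b u"
    and min: "\<And>b' u'. touches A p X b' u' \<Longrightarrow> meas (periods A p b) \<le> meas (periods A p b')"
    and b': "b' \<in> flat A p b"
  shows "same_germs A p b b'"
proof -
  have bY: "b \<in> Y" and uT: "u \<in> T" and X: "X = {a \<in> A. germ (H (p a) b) u}"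
    using t unfolding touches_def by auto
  define K where "K = (\<Union>a\<in>A. J (H (p a) b))"
  have finJ: "finite (J \<sigma>)" for \<sigma> by (rule finite_subset[OF J(1)]) simp
  \<comment> \<open>The added affine forms vanish at \<open>b\<close>, so the flat becomes the sign
    class of \<open>b\<close> and is therefore \<open>basic\<close>.\<close>
  define M where "M = L \<union> (\<lambda>i. (G i, lin (*s) n (G i) b)) ` K"
  have finM: "finite M" using finite_L A finJ by (simp add: M_def K_def)
  have flat: "flat A p b = {y. sgeq n M b y}"
  proof -
    have "y \<in> Y \<longleftrightarrow> sgeq n L b y" for y
      using bY sgeq_trans sgeq_sym unfolding Y_def by blast
    moreover have "sgeq n M b y \<longleftrightarrow> sgeq n L b y \<and> (\<forall>i\<in>K. lin (*s) n (G i) y = lin (*s) n (G i) b)" for y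
      unfolding sgeq_def M_def ball_Un by (simp add: eq_commute[of 0])
    ultimately show ?thesis unfolding flat_def K_def by auto
  qed
  define X0 where "X0 = {x \<in> flat A p b. same_germs A p b x}"
  have "X0 = {} \<or> X0 = flat A p b"
  proof (rule basic_connected)
    show "basic n (flat A p b)" unfolding flat using finM by (rule basic_sgclass)
    define M' where "M' = M \<union> (\<lambda>(i, a). (G i, c i - lin (*s) m (f i) (p a))) ` ({..<N} \<times> A)"
    have "x \<in> X0 \<longleftrightarrow> y \<in> X0" if xy: "sgeq n M' x y" for x y
    proof -
      have "x \<in> flat A p b \<longleftrightarrow> y \<in> flat A p b"
        using sgeq_mono[OF xy, of M] sgeq_trans sgeq_sym unfolding flat M'_def by blast
      moreover have "H (p a) x = H (p a) y" if a: "a \<in> A" for a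
      proof -
        have "sg (lin (*s) n (G i) x - (c i - lin (*s) m (f i) (p a))) =
              sg (lin (*s) n (G i) y - (c i - lin (*s) m (f i) (p a)))" if "i < N" for i
        proof -
          have "(G i, c i - lin (*s) m (f i) (p a)) \<in> M'" using that a unfolding M'_def by force
          then show ?thesis using xy unfolding sgeq_def by blast
        qed
        then show ?thesis by (auto simp: sgns_def fun_eq_iff algebra_simps)
      qed
      ultimately show ?thesis unfolding X0_def same_germs_def by auto
    qed
    moreover have "finite M'" using finM A by (simp add: M'_def)
    ultimately show "semilin n X0" unfolding semilin_def by blast
    show "X0 \<subseteq> flat A p b" unfolding X0_def by blast
    fix x v assume x: "x \<in> flat A p b" and ev: "eventually (\<lambda>z. (\<lambda>i. x i + v i *s z) \<in> flat A p b) small"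
    have xY: "x \<in> Y" using x unfolding flat_def by blast
    have "eventually (\<lambda>z. 0 < z \<and> (\<lambda>i. x i + v i *s z) \<in> flat A p b) small"
      using ev_pos ev by eventually_elim blast
    then obtain z where z: "0 < z" "(\<lambda>i. x i + v i *s z) \<in> flat A p b"
      using eventually_happens'[OF small_not_bot] by blast
    have vT: "v \<in> T" using T_if_Y_move[OF xY _ z(1)] z(2) unfolding flat_def by blast
    have "dot n (G i) v = 0" if "a \<in> A" "i \<in> J (H (p a) b)" for a i
    proof -
      have "lin (*s) n (G i) (\<lambda>i. x i + v i *s z) = lin (*s) n (G i) x"
        using x z(2) that unfolding flat_def by auto
      then show ?thesis using z(1) by (simp add: lin_move scale_eq_0)
    qed
    then have v: "v \<in> periods A p b" using vT unfolding periods_iff by (auto simp: J(2))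
    \<comment> \<open>Membership in \<open>X0\<close> shortly after leaving \<open>x\<close> along
      \<open>v\<close>.\<close>
    define Q where "Q \<longleftrightarrow> (\<forall>a\<in>A. \<forall>w\<in>T. germ (cmp (H (p a) x) (dsg v)) w = germ (H (p a) b) w)"
    have "eventually (\<lambda>z. \<forall>a\<in>A. H (p a) (\<lambda>i. x i + v i *s z) = cmp (H (p a) x) (dsg v)) small"
      using A by (intro eventually_ball_finite ballI sgns_move_param)
    with ev have evQ: "eventually (\<lambda>z. (\<lambda>i. x i + v i *s z) \<in> X0 \<longleftrightarrow> Q) small"
      by eventually_elim (simp add: X0_def same_germs_def Q_def)
    have "Q" if "x \<in> X0"
    proof -
      have g: "germ (H (p a) x) w = germ (H (p a) b) w" if "a \<in> A" "w \<in> T" for a w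
        using \<open>x \<in> X0\<close> that unfolding X0_def same_germs_def by blast
      have "v \<in> W (H (p a) x)" if "a \<in> A" for a
        using v that W_cong[OF g[OF that]] unfolding periods_iff by blast
      then show Q unfolding Q_def using g W_germ by metis
    qed
    moreover have "x \<in> X0" if Q: Q
    proof (rule ccontr)
      assume "x \<notin> X0"
      then have ns: "\<not> same_germs A p b x" using x unfolding X0_def by blast
      obtain e where e: "\<forall>\<sigma>. germ \<sigma> (\<lambda>i. v i + u i * e) = germ (cmp \<sigma> (dsg v)) u"
        using eventually_happens'[OF self.small_not_bot germ_move[of v u]] by blast
      \<comment> \<open>A step in two scales: \<open>v\<close> restores the germs of
        \<open>b\<close>, and the much shorter \<open>u\<close> then shows the trace.\<close>
      have "touches A p X x (\<lambda>i. v i + u i * e)"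
        unfolding touches_def X using xY T_lin[OF vT uT] e Q uT by (auto simp: Q_def)
      from min[OF this] have "meas (periods A p b) \<le> meas (periods A p x)" .
      moreover have "periods A p x \<subset> periods A p b"
        using periods_decrease[OF _ v ns] Q unfolding Q_def by blast
      ultimately show False using meas_less unfolding periods_def by (metis not_le)
    qed
    ultimately have "x \<in> X0 \<longleftrightarrow> Q" by blast
    then show "eventually (\<lambda>z. (\<lambda>i. x i + v i *s z) \<in> X0 \<longleftrightarrow> x \<in> X0) small"
      using evQ by simp
  qed
  moreover have "b \<in> X0" using bY unfolding X0_def flat_def same_germs_def by blast
  ultimately show ?thesis using b' unfolding X0_def by blast
qed

section \<open>Encoding and counting traces\<close>

definition trace :: "'z set \<Rightarrow> ('z \<Rightarrow> nat \<Rightarrow> 'r) \<Rightarrow> (nat \<Rightarrow> 'r) \<Rightarrow> 'z set" where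
  "trace A p b = {a \<in> A. Ep (H (p a) b)}"

text \<open>The touching point itself is not part of the code, since there may be infinitely many.
  Only points of \<open>A\<close> with their sign vectors and the direction signs are recorded;
  \<open>encodes_unique\<close> shows that they suffice.\<close>

definition encodes :: "'z set \<Rightarrow> ('z \<Rightarrow> nat \<Rightarrow> 'r) \<Rightarrow> 'z set \<Rightarrow> ('z \<times> (nat \<Rightarrow> int)) set \<Rightarrow> (nat \<Rightarrow> int) \<Rightarrow> bool" where
  "encodes A p X D \<tau> \<longleftrightarrow> (\<exists>b u. touches A p X b u \<and> dsg u = \<tau> \<and>
     (\<forall>(a, \<sigma>)\<in>D. a \<in> A \<and> H (p a) b = \<sigma>) \<and> WW (snd ` D) = periods A p b \<and>
     (\<forall>b'\<in>flat A p b. same_germs A p b b'))"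

lemma ex_encoding:
  assumes A: "finite A" and b: "b \<in> Y"
  shows "\<exists>D \<tau>. D \<subseteq> A \<times> Sig \<and> card D \<le> rank \<and> \<tau> \<in> sign_vectors N \<and> encodes A p (trace A p b) D \<tau>"
proof -
  let ?X = "trace A p b"
  have "touches A p ?X b (\<lambda>_. 0)" using b by (simp add: touches_def trace_def T_zero germ_zero)
  then obtain b1 u where t: "touches A p ?X b1 u"
    and min: "\<And>b' u'. touches A p ?X b' u' \<Longrightarrow> meas (periods A p b1) \<le> meas (periods A p b')"
    using ex_has_least_nat[of "\<lambda>(b, u). touches A p ?X b u" "(b, \<lambda>_. 0)" "\<lambda>(b, u). meas (periods A p b)"]
    by auto
  have same: "\<forall>b'\<in>flat A p b1. same_germs A p b1 b'"
    by (intro ballI minimal_same_germs[OF A t]) (use min in blast)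
  have b1: "b1 \<in> Y" using t unfolding touches_def by blast
  let ?S = "(\<lambda>a. H (p a) b1) ` A"
  \<comment> \<open>A smallest family with the given common periods is irredundant, hence bounded by
    \<open>rank\<close>.\<close>
  have "\<exists>\<Delta>. (\<Delta> \<subseteq> ?S \<and> WW \<Delta> = periods A p b1) \<and>
      (\<forall>\<Delta>'. \<Delta>' \<subseteq> ?S \<and> WW \<Delta>' = periods A p b1 \<longrightarrow> card \<Delta> \<le> card \<Delta>')"
    by (rule ex_has_least_nat[of "\<lambda>\<Delta>. \<Delta> \<subseteq> ?S \<and> WW \<Delta> = periods A p b1" ?S]) (simp add: periods_def)
  then obtain \<Delta> where \<Delta>: "\<Delta> \<subseteq> ?S" "WW \<Delta> = periods A p b1"
    and least: "\<forall>\<Delta>'. \<Delta>' \<subseteq> ?S \<and> WW \<Delta>' = periods A p b1 \<longrightarrow> card \<Delta> \<le> card \<Delta>'"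
    by (elim exE conjE) (rule that)
  have fin: "finite \<Delta>" using \<Delta>(1) A finite_subset by blast
  have "irr \<Delta>" unfolding irr_def
  proof (intro ballI notI)
    fix \<sigma> assume s: "\<sigma> \<in> \<Delta>" "WW \<Delta> = WW (\<Delta> - {\<sigma>})"
    then have "card \<Delta> \<le> card (\<Delta> - {\<sigma>})"
      using \<Delta> by (intro least[THEN spec, THEN mp] conjI) auto
    then show False using s(1) fin by (metis card_Diff1_less not_le)
  qed
  moreover have "\<Delta> \<subseteq> Sig" using \<Delta>(1) sgns_Sig[OF b1] by blast
  ultimately have card: "card \<Delta> \<le> rank" by (rule irr_rank(2)[rotated])
  have "\<exists>a. a \<in> A \<and> H (p a) b1 = \<sigma>" if "\<sigma> \<in> \<Delta>" for \<sigma> using that \<Delta>(1) by auto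
  then obtain g where g: "\<And>\<sigma>. \<sigma> \<in> \<Delta> \<Longrightarrow> g \<sigma> \<in> A \<and> H (p (g \<sigma>)) b1 = \<sigma>" by metis
  define D where "D = (\<lambda>\<sigma>. (g \<sigma>, \<sigma>)) ` \<Delta>"
  have "snd ` D = \<Delta>" by (force simp: D_def)
  then have "encodes A p ?X D (dsg u)"
    unfolding encodes_def using t same \<Delta>(2) g by (intro exI[of _ b1] exI[of _ u]) (auto simp: D_def)
  moreover have "D \<subseteq> A \<times> Sig" using g \<open>\<Delta> \<subseteq> Sig\<close> by (auto simp: D_def)
  moreover have "card D \<le> rank" using card card_image_le[OF fin, of "\<lambda>\<sigma>. (g \<sigma>, \<sigma>)"] by (simp add: D_def)
  ultimately show ?thesis using dsg_in by blast
qed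

text \<open>For a recorded pair, the forms in \<open>J \<sigma>\<close> take equal values at both
  touching points, because the sign is 0 there. Together with the equations of \<open>Y\<close>
  these forms cut out the common periods at \<open>b1\<close>, so by
  \<open>lin_kernel_transfer\<close> all equations of the flat of \<open>b1\<close> hold at
  \<open>b2\<close>. Germs are constant on that flat, and they see a direction only through its
  signs.\<close>

lemma encodes_unique:
  assumes A: "finite A" and D: "finite D" and 1: "encodes A p X1 D \<tau>" and 2: "encodes A p X2 D \<tau>"
  shows "X1 = X2"
proof -
  obtain b1 u1 where 1: "touches A p X1 b1 u1" "dsg u1 = \<tau>"
     "\<forall>(a, \<sigma>)\<in>D. a \<in> A \<and> H (p a) b1 = \<sigma>" "WW (snd ` D) = periods A p b1"
     "\<forall>b'\<in>flat A p b1. same_germs A p b1 b'"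
    using 1 unfolding encodes_def by blast
  obtain b2 u2 where 2: "touches A p X2 b2 u2" "dsg u2 = \<tau>"
     "\<forall>(a, \<sigma>)\<in>D. a \<in> A \<and> H (p a) b2 = \<sigma>"
    using 2 unfolding encodes_def by blast
  note D2 = 2(3)
  have Y: "b1 \<in> Y" "b2 \<in> Y" using 1(1) 2(1) unfolding touches_def by auto
  have finJ: "finite (J \<sigma>)" for \<sigma> by (rule finite_subset[OF J(1)]) simp
  define Rs where "Rs = {l. (l, lin (*s) n l b0) \<in> L} \<union> G ` (\<Union>\<sigma>\<in>snd ` D. J \<sigma>)"
  have "lin (*s) n (G i) b2 = lin (*s) n (G i) b1" if i: "a \<in> A" "i \<in> J (H (p a) b1)" for a i
  proof -
    have "lin (*s) n (G i) (\<lambda>j. b2 j - b1 j) = 0"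
    proof (rule lin_kernel_transfer)
      have "{l. (l, lin (*s) n l b0) \<in> L} \<subseteq> fst ` L" by force
      then show "finite Rs" unfolding Rs_def using finite_L D finJ finite_subset by blast
      show "\<forall>v. (\<forall>r\<in>Rs. dot n r v = 0) \<longrightarrow> dot n (G i) v = 0"
      proof (intro allI impI)
        fix v assume v: "\<forall>r\<in>Rs. dot n r v = 0"
        have vT: "v \<in> T" using v unfolding T_def Rs_def by auto
        have "v \<in> W \<sigma>" if "\<sigma> \<in> snd ` D" for \<sigma>
          using v vT that unfolding J(2)[of \<sigma>] Rs_def by blast
        then have "v \<in> periods A p b1" using vT WW_I 1(4) by blast
        then have "v \<in> W (H (p a) b1)" using i(1) unfolding periods_iff by blast
        then show "dot n (G i) v = 0" using J(2)[of "H (p a) b1"] i(2) by blast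
      qed
      show "\<forall>r\<in>Rs. lin (*s) n r (\<lambda>j. b2 j - b1 j) = 0"
      proof
        fix r assume "r \<in> Rs"
        then consider "(r, lin (*s) n r b0) \<in> L" | a' \<sigma> j where "(a', \<sigma>) \<in> D" "j \<in> J \<sigma>" "r = G j"
          unfolding Rs_def by force
        then show "lin (*s) n r (\<lambda>j. b2 j - b1 j) = 0"
        proof cases
          case 1
          then show ?thesis using Y_eq[OF Y(1) 1] Y_eq[OF Y(2) 1] by (simp add: lin_diff)
        next
          case (2 a' \<sigma> j)
          have j: "j < N" "\<sigma> j = 0" using J(1) 2(2) by blast+
          have "H (p a') b1 j = 0" "H (p a') b2 j = 0"
            using 1(3) D2 2(1) j by auto
          then show ?thesis using j(1) 2(3) by (simp add: sgns_def lin_diff) (metis add_left_cancel)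
        qed
      qed
    qed
    then show ?thesis by (simp add: lin_diff)
  qed
  then have "b2 \<in> flat A p b1" unfolding flat_def using Y by blast
  then have "same_germs A p b1 b2" using 1(5) by blast
  moreover have "germ \<sigma> u1 = germ \<sigma> u2" for \<sigma> using 1(2) 2(2) by (simp add: germ_def)
  ultimately show ?thesis using 1(1) 2(1) unfolding touches_def same_germs_def by auto
qed

lemma card_traces_le:
  assumes A: "finite A" "A \<noteq> {}"
  shows "finite (trace A p ` Y)"
    and "card (trace A p ` Y) \<le> (rank + 1) * card Sig ^ rank * card (sign_vectors N) * card A ^ rank"
proof -
  define \<D> where "\<D> = {D. D \<subseteq> A \<times> Sig \<and> card D \<le> rank}"
  have finAS: "finite (A \<times> Sig)" using A finite_Sig by simp
  then have fin: "finite \<D>" unfolding \<D>_def by simp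
  define h where "h = (\<lambda>(D, \<tau>). THE X. encodes A p X D \<tau>)"
  have sub: "trace A p ` Y \<subseteq> h ` (\<D> \<times> sign_vectors N)"
  proof
    fix X assume "X \<in> trace A p ` Y"
    then obtain b where b: "b \<in> Y" "X = trace A p b" by blast
    obtain D \<tau> where D: "D \<subseteq> A \<times> Sig" "card D \<le> rank" "\<tau> \<in> sign_vectors N" "encodes A p X D \<tau>"
      using ex_encoding[OF A(1) b(1), of p] b(2) by blast
    have "finite D" using D(1) finAS finite_subset by blast
    then have "h (D, \<tau>) = X"
      unfolding h_def prod.case using D(4)
      by (intro the_equality) (simp, rule encodes_unique[OF A(1) \<open>finite D\<close> _ D(4)])
    moreover have "(D, \<tau>) \<in> \<D> \<times> sign_vectors N" using D by (simp add: \<D>_def)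
    ultimately show "X \<in> h ` (\<D> \<times> sign_vectors N)" by (metis image_eqI)
  qed
  have finD: "finite (\<D> \<times> sign_vectors N)" using fin finite_sign_vectors by simp
  then show "finite (trace A p ` Y)" using sub finite_subset by blast
  \<comment> \<open>Small sets are counted by lists enumerating them; the factor
    \<open>rank + 1\<close> stands for the possible lengths.\<close>
  have "\<D> \<subseteq> set ` {xs. set xs \<subseteq> A \<times> Sig \<and> length xs \<le> rank}"
  proof
    fix D assume "D \<in> \<D>"
    then have D: "D \<subseteq> A \<times> Sig" "card D \<le> rank" "finite D" using finAS finite_subset by (auto simp: \<D>_def)
    then obtain xs where "set xs = D" "distinct xs" using finite_distinct_list by blast
    then show "D \<in> set ` {xs. set xs \<subseteq> A \<times> Sig \<and> length xs \<le> rank}"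
      using D distinct_card[of xs] by auto
  qed
  then have "card \<D> \<le> card {xs. set xs \<subseteq> A \<times> Sig \<and> length xs \<le> rank}"
    using finite_lists_length_le[OF finAS] by (meson card_image_le card_mono finite_imageI le_trans)
  also have "\<dots> = (\<Sum>i\<le>rank. card (A \<times> Sig) ^ i)" by (rule card_lists_length_le[OF finAS])
  also have "\<dots> \<le> (\<Sum>i\<le>rank. card (A \<times> Sig) ^ rank)"
  proof (intro sum_mono power_increasing)
    have "A \<times> Sig \<noteq> {}" using A by (auto simp: Sig_def)
    then show "1 \<le> card (A \<times> Sig)" using finAS by (simp add: Suc_leI card_gt_0_iff del: card_cartesian_product)
  qed simp
  finally have "card \<D> \<le> (rank + 1) * card Sig ^ rank * card A ^ rank"
    by (simp add: card_cartesian_product power_mult_distrib algebra_simps)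
  then have "card \<D> * card (sign_vectors N) \<le> (rank + 1) * card Sig ^ rank * card A ^ rank * card (sign_vectors N)"
    by (rule mult_le_mono1)
  moreover have "card (trace A p ` Y) \<le> card (\<D> \<times> sign_vectors N)"
    using sub finD by (meson card_image_le card_mono finite_imageI le_trans)
  ultimately show "card (trace A p ` Y) \<le> (rank + 1) * card Sig ^ rank * card (sign_vectors N) * card A ^ rank"
    by (simp only: card_cartesian_product mult_ac)
qed

end

section \<open>The lower bound on a piece\<close>

lemma (in left_ovs) of_nat_pos: "0 < k \<Longrightarrow> 0 < (of_nat k :: 'd)"
proof (induction k)
  case (Suc k)
  then show ?case using zero_less_one_ring by (cases "k = 0") (auto intro: add_pos_pos)
qed simp

context piece
begin

text \<open>A small step along \<open>v\<close> solves the linear system for \<open>\<mu>\<close> over \<open>R\<close>, hence it is solvable over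
  \<open>D\<close>.\<close>

lemma ex_lift_direction:
  assumes v: "v \<in> T"
  shows "\<exists>\<mu>. \<forall>i<N. H a b0 i = 0 \<longrightarrow> dot m (f i) \<mu> + dot n (G i) v = 0"
proof -
  have "eventually (\<lambda>z. 0 < z \<and> (\<lambda>i. b0 i + v i *s z) \<in> Y) small"
    using ev_pos Y_move[OF b0_in_Y v] by eventually_elim blast
  then obtain z where z: "0 < z" "(\<lambda>i. b0 i + v i *s z) \<in> Y"
    using eventually_happens'[OF small_not_bot] by blast
  obtain a' where a': "H a' (\<lambda>i. b0 i + v i *s z) = H a b0"
    using spread[of b0 "\<lambda>i. b0 i + v i *s z" a] z(2) b0_in_Y unfolding Y_def by blast
  define I where "I = {i. i < N \<and> H a b0 i = 0}"
  \<comment> \<open>The homogenised system, with the step length as coordinate 0, which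
    \<open>g\<close> reads off. A solution over \<open>'r\<close> with nonzero step shows that
    \<open>g\<close> does not vanish on the kernel over \<open>'d\<close>; dividing a kernel vector
    by its step gives the required direction.\<close>
  define r where "r i = case_nat (dot n (G i) v) (f i)" for i
  define g where "g = case_nat (1::'d) (\<lambda>_. 0)"
  have tail: "case_nat x y \<circ> Suc = y" for x :: 'x and y by (simp add: fun_eq_iff)
  have r: "lin (*s) (Suc m) (r i) (case_nat x y) = dot n (G i) v *s x + lin (*s) m (f i) y" for i x y
    by (simp add: lin_Suc_case_nat r_def tail)
  have rd: "dot (Suc m) (r i) (case_nat x y) = dot n (G i) v * x + dot m (f i) y" for i x y
    by (simp add: lin_Suc_case_nat r_def tail)
  have gd: "dot (Suc m) g (case_nat x y) = x" for x y
    by (simp add: lin_Suc_case_nat g_def tail) (simp add: lin_def)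
  have "lin (*s) (Suc m) (r i) (case_nat z (\<lambda>j. a' j - a j)) = 0" if "i \<in> I" for i
  proof -
    have i: "i < N" "H a b0 i = 0" "H a' (\<lambda>i. b0 i + v i *s z) i = 0" using that a' by (auto simp: I_def)
    have "lin (*s) m (f i) a + lin (*s) n (G i) b0 - c i = 0"
      "lin (*s) m (f i) a' + (lin (*s) n (G i) b0 + dot n (G i) v *s z) - c i = 0"
      using i(2,3) by (simp_all add: sgns_def i(1) lin_move)
    then have "lin (*s) m (f i) a' + (lin (*s) n (G i) b0 + dot n (G i) v *s z) - c i
       - (lin (*s) m (f i) a + lin (*s) n (G i) b0 - c i) = 0" by simp
    then show ?thesis unfolding r lin_diff by (simp add: algebra_simps)
  qed
  moreover have "lin (*s) (Suc m) g (case_nat z (\<lambda>j. a' j - a j)) \<noteq> 0"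
    using z(1) by (simp add: lin_Suc_case_nat g_def tail scale_one) (simp add: lin_def)
  moreover have "finite (r ` I)" by (simp add: I_def)
  ultimately have "\<not> (\<forall>w. (\<forall>r\<in>r ` I. dot (Suc m) r w = 0) \<longrightarrow> dot (Suc m) g w = 0)"
    using lin_kernel_transfer[of "r ` I" "Suc m" g "case_nat z (\<lambda>j. a' j - a j)"] by auto
  then obtain w where w: "\<forall>i\<in>I. dot (Suc m) (r i) w = 0" "dot (Suc m) g w \<noteq> 0" by auto
  have "w = case_nat (w 0) (w \<circ> Suc)" by (auto simp: fun_eq_iff split: nat.split)
  then obtain x y where xy: "w = case_nat x y" by blast
  have x: "x \<noteq> 0" using w(2) by (simp add: xy gd)
  have "dot m (f i) (\<lambda>j. y j * inverse x) + dot n (G i) v = 0" if "i < N" "H a b0 i = 0" for i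
  proof -
    have "dot n (G i) v * x + dot m (f i) y = 0" using w(1) that by (simp add: xy rd I_def)
    then have "(dot n (G i) v * x + dot m (f i) y) * inverse x = 0" by simp
    then show ?thesis using x by (simp add: self.lin_scale_right distrib_right mult.assoc add.commute)
  qed
  then show ?thesis by blast
qed

text \<open>All positive multiples of \<open>v\<close> have the same signs, so the vector
  \<open>u\<close> showing that \<open>v\<close> is no period serves for each of them. Shrinking
  \<open>u\<close> by one small \<open>e\<close> handles finitely many multiples together.\<close>

lemma ex_offset:
  assumes "v \<in> T" "v \<notin> W \<sigma>"
  shows "\<exists>w\<in>T. \<forall>j\<in>{1..k}. germ \<sigma> (\<lambda>i. v i * of_nat j + w i) \<noteq> germ \<sigma> w"
proof -
  obtain u where u: "u \<in> T" "germ (cmp \<sigma> (dsg v)) u \<noteq> germ \<sigma> u" using assms unfolding W_def by blast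
  have "eventually (\<lambda>e. \<forall>j\<in>{1..k}. \<forall>\<sigma>. germ \<sigma> (\<lambda>i. v i * of_nat j + u i * e)
      = germ (cmp \<sigma> (dsg (\<lambda>i. v i * of_nat j))) u) small"
    by (intro eventually_ball_finite ballI germ_move) simp
  then have "eventually (\<lambda>e. 0 < e \<and> (\<forall>j\<in>{1..k}. \<forall>\<sigma>. germ \<sigma> (\<lambda>i. v i * of_nat j + u i * e)
      = germ (cmp \<sigma> (dsg (\<lambda>i. v i * of_nat j))) u)) small"
    using self.ev_pos by eventually_elim blast
  then obtain e where e: "0 < e" "\<forall>j\<in>{1..k}. \<forall>\<sigma>. germ \<sigma> (\<lambda>i. v i * of_nat j + u i * e)
      = germ (cmp \<sigma> (dsg (\<lambda>i. v i * of_nat j))) u"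
    using eventually_happens'[OF self.small_not_bot] by blast
  have "germ \<sigma> (\<lambda>i. v i * of_nat j + u i * e) \<noteq> germ \<sigma> (\<lambda>i. u i * e)" if j: "j \<in> {1..k}" for j
  proof -
    have "dsg (\<lambda>i. v i * of_nat j) = dsg v" using j by (intro dsg_scale of_nat_pos) simp
    then show ?thesis using e(2) j u(2) germ_scale[OF e(1), of \<sigma> u] by simp
  qed
  then show ?thesis using T_scale[OF u(1)] by (intro bexI[of _ "\<lambda>i. u i * e"]) auto
qed

lemma germ_add_periods:
  assumes "finite \<Delta>" "\<And>\<tau>. \<tau> \<in> \<Delta> \<Longrightarrow> v \<tau> \<in> W \<sigma>" "w \<in> T"
  shows "germ \<sigma> (\<lambda>i. (\<Sum>\<tau>\<in>\<Delta>. v \<tau> i * of_nat (\<kappa> \<tau>)) + w i) = germ \<sigma> w"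
proof -
  have "(\<lambda>i. \<Sum>\<tau>\<in>\<Delta>. v \<tau> i * of_nat (\<kappa> \<tau>)) \<in> W \<sigma>"
    using assms(1,2)
  proof (induction \<Delta> rule: finite_induct)
    case (insert \<tau> \<Delta>)
    then show ?case using W_add[OF W_of_nat[of "v \<tau>" \<sigma> "\<kappa> \<tau>"]] by simp
  qed (simp add: W_zero)
  from W_period[OF this assms(3)] show ?thesis by (simp add: add.commute)
qed

text \<open>For each \<open>\<sigma>\<close> in an irredundant set, \<open>k\<close> translates of the germ of \<open>\<sigma>\<close> along a common
  period \<open>v \<sigma>\<close> of all the other germs cut a grid into \<open>k\<close> slices.\<close>

lemma ex_separated:
  "\<exists>A B. finite A \<and> card A \<le> rank * k \<and> finite B \<and> B \<subseteq> Y \<and> card B = k ^ rank \<and>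
     (\<forall>b\<in>B. \<forall>b'\<in>B. b \<noteq> b' \<longrightarrow> (\<exists>a\<in>A. Ep (H a b) \<noteq> Ep (H a b')))"
proof -
  obtain \<Delta> where \<Delta>: "\<Delta> \<subseteq> Sig" "irr \<Delta>" "card \<Delta> = rank" using irr_rank(1) by blast
  have fin: "finite \<Delta>" using \<Delta>(1) finite_Sig finite_subset by blast
  obtain v where v: "\<And>\<sigma>. \<sigma> \<in> \<Delta> \<Longrightarrow> v \<sigma> \<in> WW (\<Delta> - {\<sigma>})" "\<And>\<sigma>. \<sigma> \<in> \<Delta> \<Longrightarrow> v \<sigma> \<notin> W \<sigma>"
    using irr_witness[OF \<Delta>(2)] by blast
  have vT: "v \<sigma> \<in> T" if "\<sigma> \<in> \<Delta>" for \<sigma> using v(1)[OF that] by (rule WW_T)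
  have vW: "v \<tau> \<in> W \<sigma>" if "\<sigma> \<in> \<Delta>" "\<tau> \<in> \<Delta> - {\<sigma>}" for \<sigma> \<tau>
    using that v(1)[of \<tau>] by (intro WW_D[of _ "\<Delta> - {\<tau>}"]) auto
  obtain w where w: "\<And>\<sigma>. \<sigma> \<in> \<Delta> \<Longrightarrow> w \<sigma> \<in> T"
    "\<And>\<sigma> j. \<sigma> \<in> \<Delta> \<Longrightarrow> j \<in> {1..k} \<Longrightarrow> germ \<sigma> (\<lambda>i. v \<sigma> i * of_nat j + w \<sigma> i) \<noteq> germ \<sigma> (w \<sigma>)"
    using ex_offset[OF vT v(2), of _ k] by metis
  have "\<exists>a. H a b0 = \<sigma>" if "\<sigma> \<in> \<Delta>" for \<sigma> using that \<Delta>(1) unfolding Sig_def by auto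
  then obtain a where a: "\<And>\<sigma>. \<sigma> \<in> \<Delta> \<Longrightarrow> H (a \<sigma>) b0 = \<sigma>" by metis
  have "\<exists>\<mu>. \<forall>i<N. \<sigma> i = 0 \<longrightarrow> dot m (f i) \<mu> + dot n (G i) u = 0" if "\<sigma> \<in> \<Delta>" "u \<in> T" for \<sigma> u
    using ex_lift_direction[OF that(2), of "a \<sigma>"] a[OF that(1)] by simp
  then obtain lift where lift: "\<And>\<sigma> u i. \<sigma> \<in> \<Delta> \<Longrightarrow> u \<in> T \<Longrightarrow> i < N \<Longrightarrow> \<sigma> i = 0 \<Longrightarrow>
      dot m (f i) (lift \<sigma> u) + dot n (G i) u = 0" by metis
  \<comment> \<open>The shift of the point is chosen so that, on the forms vanishing at
    \<open>\<sigma>\<close>, the displacement \<open>dir \<kappa>\<close> is seen as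
    \<open>dir \<kappa> - v \<sigma> * q + w \<sigma>\<close>.\<close>
  define \<mu> where "\<mu> \<sigma> q = (\<lambda>i. lift \<sigma> (v \<sigma>) i * of_nat q - lift \<sigma> (w \<sigma>) i)" for \<sigma> and q :: nat
  define dir where "dir \<kappa> = (\<lambda>i. \<Sum>\<tau>\<in>\<Delta>. v \<tau> i * of_nat (\<kappa> \<tau>))" for \<kappa> :: "_ \<Rightarrow> nat"
  define pa where "pa z \<sigma> q = (\<lambda>i. a \<sigma> i + \<mu> \<sigma> q i *s z)" for z \<sigma> q
  define pb where "pb z \<kappa> = (\<lambda>i. b0 i + dir \<kappa> i *s z)" for z \<kappa>
  define K where "K = PiE \<Delta> (\<lambda>_. {..<k})"
  have finK: "finite K" and cardK: "card K = k ^ rank"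
    using fin \<Delta>(3) by (auto simp: K_def card_PiE intro: finite_PiE)
  have dirT: "dir \<kappa> \<in> T" for \<kappa>
  proof -
    have "(\<lambda>i. \<Sum>\<tau>\<in>\<Delta>'. v \<tau> i * of_nat (\<kappa> \<tau>)) \<in> T" if "finite \<Delta>'" "\<Delta>' \<subseteq> \<Delta>" for \<Delta>'
      using that
    proof (induction \<Delta>' rule: finite_induct)
      case (insert \<tau> \<Delta>')
      then show ?case using T_add[OF T_scale[OF vT[of \<tau>], of "of_nat (\<kappa> \<tau>)"]] by simp
    qed (simp add: T_zero)
    then show ?thesis using fin unfolding dir_def by blast
  qed
  have rel: "cmp \<sigma> (\<lambda>i. if i < N then sg (dot m (f i) (\<mu> \<sigma> q) + dot n (G i) (dir \<kappa>)) else 0)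
      = cmp \<sigma> (dsg (\<lambda>i. dir \<kappa> i - v \<sigma> i * of_nat q + w \<sigma> i))" if s: "\<sigma> \<in> \<Delta>" for \<sigma> q \<kappa>
  proof -
    have "dot m (f i) (\<mu> \<sigma> q) + dot n (G i) (dir \<kappa>)
        = dot n (G i) (\<lambda>i. dir \<kappa> i - v \<sigma> i * of_nat q + w \<sigma> i)" if "i < N" "\<sigma> i = 0" for i
    proof -
      have "dot m (f i) (lift \<sigma> (v \<sigma>)) = - dot n (G i) (v \<sigma>)" "dot m (f i) (lift \<sigma> (w \<sigma>)) = - dot n (G i) (w \<sigma>)"
        using lift[OF s vT[OF s] that] lift[OF s w(1)[OF s] that] by (simp_all add: eq_neg_iff_add_eq_0)
      then show ?thesis unfolding \<mu>_def by (simp add: self.lin_diff self.lin_add self.lin_scale_right)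
    qed
    then show ?thesis by (auto simp: cmp_def dsg_def fun_eq_iff)
  qed
  \<comment> \<open>Points and parameters move with the same \<open>z\<close>, so that both
    displacements add up to one scalar times \<open>z\<close>; finitely many conditions leave a
    common choice of it.\<close>
  have "eventually (\<lambda>z. \<forall>\<kappa>\<in>K. pb z \<kappa> \<in> Y \<and> (\<forall>\<sigma>\<in>\<Delta>. \<forall>q\<in>{..<k}. H (pa z \<sigma> q) (pb z \<kappa>)
      = cmp (H (a \<sigma>) b0) (\<lambda>i. if i < N then sg (dot m (f i) (\<mu> \<sigma> q) + dot n (G i) (dir \<kappa>)) else 0))) small"
    unfolding pa_def pb_def using finK fin
    by (intro eventually_ball_finite ballI eventually_conj sgns_move Y_move b0_in_Y dirT) auto
  then obtain z where z: "\<forall>\<kappa>\<in>K. pb z \<kappa> \<in> Y \<and> (\<forall>\<sigma>\<in>\<Delta>. \<forall>q\<in>{..<k}. H (pa z \<sigma> q) (pb z \<kappa>)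
      = cmp (H (a \<sigma>) b0) (\<lambda>i. if i < N then sg (dot m (f i) (\<mu> \<sigma> q) + dot n (G i) (dir \<kappa>)) else 0))"
    using eventually_happens'[OF small_not_bot] by blast
  \<comment> \<open>The summands of \<open>dir \<kappa>\<close> other than that of
    \<open>\<sigma>\<close> are periods and drop out. For \<open>j = 0\<close> the value is that at
    \<open>w \<sigma>\<close>, and for \<open>1 \<le> j \<le> k\<close> it is the opposite one. So
    slice \<open>q = \<kappa> \<sigma>\<close> tells \<open>\<kappa>\<close> from every
    \<open>\<kappa>'\<close> with a larger value at \<open>\<sigma>\<close>.\<close>
  have mem: "Ep (H (pa z \<sigma> q) (pb z \<kappa>)) \<longleftrightarrow> germ \<sigma> (\<lambda>i. v \<sigma> i * of_nat j + w \<sigma> i)"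
    if s: "\<sigma> \<in> \<Delta>" and "q < k" "\<kappa> \<in> K" "\<kappa> \<sigma> = q + j" for \<sigma> q \<kappa> j
  proof -
    have "Ep (H (pa z \<sigma> q) (pb z \<kappa>)) \<longleftrightarrow> germ \<sigma> (\<lambda>i. dir \<kappa> i - v \<sigma> i * of_nat q + w \<sigma> i)"
      using z that rel[OF s] a[OF s] by (simp add: germ_def)
    also have "(\<lambda>i. dir \<kappa> i - v \<sigma> i * of_nat q + w \<sigma> i)
        = (\<lambda>i. (\<Sum>\<tau>\<in>\<Delta> - {\<sigma>}. v \<tau> i * of_nat (\<kappa> \<tau>)) + (v \<sigma> i * of_nat j + w \<sigma> i))"
      unfolding dir_def sum.remove[OF fin s] that(4) by (simp add: algebra_simps)
    also have "germ \<sigma> \<dots> \<longleftrightarrow> germ \<sigma> (\<lambda>i. v \<sigma> i * of_nat j + w \<sigma> i)"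
      using fin vW s T_add[OF T_scale[OF vT[OF s]] w(1)[OF s]] by (intro germ_add_periods) auto
    finally show ?thesis .
  qed
  have sep: "\<exists>\<sigma>\<in>\<Delta>. \<exists>q<k. Ep (H (pa z \<sigma> q) (pb z \<kappa>)) \<noteq> Ep (H (pa z \<sigma> q) (pb z \<kappa>'))"
    if "\<kappa> \<in> K" "\<kappa>' \<in> K" "\<sigma> \<in> \<Delta>" "\<kappa> \<sigma> < \<kappa>' \<sigma>" for \<kappa> \<kappa>' \<sigma>
  proof -
    have lt: "\<kappa> \<sigma> < k" "\<kappa>' \<sigma> < k" using that unfolding K_def by (auto simp: PiE_iff)
    define j where "j = \<kappa>' \<sigma> - \<kappa> \<sigma>"
    have j: "\<kappa>' \<sigma> = \<kappa> \<sigma> + j" "j \<in> {1..k}" using that lt by (auto simp: j_def)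
    show ?thesis
      using mem[OF that(3) lt(1) that(1), of 0] mem[OF that(3) lt(1) that(2) j(1)] w(2)[OF that(3) j(2)] that(3) lt(1)
      by (intro bexI[of _ \<sigma>] exI[of _ "\<kappa> \<sigma>"]) auto
  qed
  define A where "A = (\<lambda>(\<sigma>, q). pa z \<sigma> q) ` (\<Delta> \<times> {..<k})"
  have sepA: "\<exists>a\<in>A. Ep (H a (pb z \<kappa>)) \<noteq> Ep (H a (pb z \<kappa>'))" if "\<kappa> \<in> K" "\<kappa>' \<in> K" "\<kappa> \<noteq> \<kappa>'" for \<kappa> \<kappa>'
  proof -
    have "\<exists>\<sigma>\<in>\<Delta>. \<kappa> \<sigma> \<noteq> \<kappa>' \<sigma>"
    proof (rule ccontr)
      assume "\<not> (\<exists>\<sigma>\<in>\<Delta>. \<kappa> \<sigma> \<noteq> \<kappa>' \<sigma>)"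
      then have "\<kappa> = \<kappa>'" using that(1,2) unfolding K_def by (intro PiE_ext) auto
      then show False using that(3) by simp
    qed
    then obtain \<sigma> where s: "\<sigma> \<in> \<Delta>" "\<kappa> \<sigma> \<noteq> \<kappa>' \<sigma>" by blast
    have "\<exists>\<sigma>\<in>\<Delta>. \<exists>q<k. Ep (H (pa z \<sigma> q) (pb z \<kappa>)) \<noteq> Ep (H (pa z \<sigma> q) (pb z \<kappa>'))"
    proof (cases "\<kappa> \<sigma> < \<kappa>' \<sigma>")
      case False
      then have "\<kappa>' \<sigma> < \<kappa> \<sigma>" using s(2) by simp
      from sep[OF that(2,1) s(1) this] obtain \<tau> q where "\<tau> \<in> \<Delta>" "q < k"
        "Ep (H (pa z \<tau> q) (pb z \<kappa>')) \<noteq> Ep (H (pa z \<tau> q) (pb z \<kappa>))" by blast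
      then show ?thesis by (intro bexI[of _ \<tau>] exI[of _ q]) auto
    qed (rule sep[OF that(1,2) s(1)])
    then show ?thesis unfolding A_def by force
  qed
  have inj: "inj_on (pb z) K"
  proof (rule inj_onI, rule ccontr)
    fix \<kappa> \<kappa>' assume "\<kappa> \<in> K" "\<kappa>' \<in> K" "pb z \<kappa> = pb z \<kappa>'" "\<kappa> \<noteq> \<kappa>'"
    then show False using sepA[of \<kappa> \<kappa>'] by simp
  qed
  have "card A \<le> rank * k"
    using card_image_le[of "\<Delta> \<times> {..<k}" "\<lambda>(\<sigma>, q). pa z \<sigma> q"] fin \<Delta>(3)
    by (simp add: A_def card_cartesian_product)
  moreover have "finite A" using fin by (simp add: A_def)
  moreover have "finite (pb z ` K)" "pb z ` K \<subseteq> Y" "card (pb z ` K) = k ^ rank"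
    using finK z cardK card_image[OF inj] by auto
  ultimately show ?thesis using sepA by (intro exI[of _ A] exI[of _ "pb z ` K"]) auto
qed

end

section \<open>Decomposition of the parameter space\<close>

context left_ovs
begin

lemma lin_cong: "(\<And>i. i < k \<Longrightarrow> x i = y i) \<Longrightarrow> lin (*s) k l x = lin (*s) k l y"
  unfolding lin_def by (intro sum.cong) auto

lemma sgeq_cong:
  "(\<And>i. i < k \<Longrightarrow> x i = x' i) \<Longrightarrow> (\<And>i. i < k \<Longrightarrow> y i = y' i) \<Longrightarrow> sgeq k L x y \<longleftrightarrow> sgeq k L x' y'"
  using lin_cong[of k x x'] lin_cong[of k y y'] unfolding sgeq_def by simp

lemma lin_join:
  "lin (*s) (m + n) l (\<lambda>i. if i < m then a i else b (i - m)) = lin (*s) m l a + lin (*s) n (\<lambda>j. l (m + j)) b"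
  by (induction n) (simp_all add: lin_def add.assoc)

lemma semilin_project_many:
  assumes "semilin (m + n) X"
  shows "semilin n {b. \<exists>a. (\<lambda>i. if i < m then a i else b (i - m)) \<in> X}"
  using assms
proof (induction m arbitrary: X)
  case (Suc m)
  define X' where "X' = {x. \<exists>y. case_nat y x \<in> X}"
  have j: "(\<lambda>i. if i < Suc m then a i else b (i - Suc m))
     = case_nat (a 0) (\<lambda>i. if i < m then a (Suc i) else b (i - m))" for a b :: "nat \<Rightarrow> 'r"
    by (auto simp: fun_eq_iff split: nat.split)
  have "(\<exists>a. (\<lambda>i. if i < Suc m then a i else b (i - Suc m)) \<in> X) \<longleftrightarrow>
        (\<exists>a. (\<lambda>i. if i < m then a i else b (i - m)) \<in> X')" for b
  proof
    assume "\<exists>a. (\<lambda>i. if i < m then a i else b (i - m)) \<in> X'"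
    then obtain a y where "case_nat y (\<lambda>i. if i < m then a i else b (i - m)) \<in> X" unfolding X'_def by blast
    then show "\<exists>a. (\<lambda>i. if i < Suc m then a i else b (i - Suc m)) \<in> X"
      by (intro exI[of _ "case_nat y a"]) (simp add: j cong: if_cong)
  next
    assume "\<exists>a. (\<lambda>i. if i < Suc m then a i else b (i - Suc m)) \<in> X"
    then obtain a where "case_nat (a 0) (\<lambda>i. if i < m then a (Suc i) else b (i - m)) \<in> X" unfolding j by blast
    then show "\<exists>a. (\<lambda>i. if i < m then a i else b (i - m)) \<in> X'"
      unfolding X'_def by (intro exI[of _ "\<lambda>i. a (Suc i)"]) auto
  qed
  moreover have "semilin (m + n) X'" using Suc.prems unfolding X'_def by (intro semilin_project) simp
  ultimately show ?case using Suc.IH by simp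
qed simp

text \<open>Adding the forms that decide these sets, for each of the finitely many sign vectors, to
  the partition of the parameter space is what yields \<open>spread\<close>.\<close>

lemma semilin_realised:
  assumes "\<sigma> \<in> sign_vectors N"
  shows "semilin n {b. \<exists>a. sgns m n N f G c a b = \<sigma>}"
proof -
  define l where "l i = (\<lambda>j. if j < m then f i j else G i (j - m))" for i
  define X where "X = {z. (\<lambda>i. if i < N then sg (lin (*s) (m + n) (l i) z - c i) else 0) = \<sigma>}"
  have "z \<in> X \<longleftrightarrow> z' \<in> X" if "sgeq (m + n) ((\<lambda>i. (l i, c i)) ` {..<N}) z z'" for z z'
  proof -
    have "(\<lambda>i. if i < N then sg (lin (*s) (m + n) (l i) z - c i) else 0)
       = (\<lambda>i. if i < N then sg (lin (*s) (m + n) (l i) z' - c i) else 0)"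
      using that by (auto simp: sgeq_def fun_eq_iff)
    then show ?thesis by (simp add: X_def)
  qed
  then have "semilin (m + n) X" unfolding semilin_def
    by (intro exI[of _ "(\<lambda>i. (l i, c i)) ` {..<N}"]) auto
  then have "semilin n {b. \<exists>a. (\<lambda>i. if i < m then a i else b (i - m)) \<in> X}" by (rule semilin_project_many)
  moreover have "lin (*s) (m + n) (l i) (\<lambda>i. if i < m then a i else b (i - m))
      = lin (*s) m (f i) a + lin (*s) n (G i) b" for i a b
    unfolding lin_join by (simp add: lin_def l_def)
  then have "(\<lambda>i. if i < m then a i else b (i - m)) \<in> X \<longleftrightarrow> sgns m n N f G c a b = \<sigma>" for a b
    by (simp only: X_def sgns_def mem_Collect_eq)
  ultimately show ?thesis by simp
qed

lemma semilinear_signs: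
  assumes "semilinear (*s) k X"
  obtains L where "finite L"
    "\<And>x y. length x = k \<Longrightarrow> length y = k \<Longrightarrow> sgeq k L ((!) x) ((!) y) \<Longrightarrow> x \<in> X \<longleftrightarrow> y \<in> X"
proof -
  obtain F :: "('d, 'r) linear_ineq set set" where F: "finite F" "\<forall>\<Phi>\<in>F. finite \<Phi>"
    "X = (\<Union>\<Phi>\<in>F. {x \<in> coord_space k. \<forall>\<phi>\<in>\<Phi>. satisfies (*s) x \<phi>})"
    using assms unfolding semilinear_def by blast
  define h :: "('d, 'r) linear_ineq \<Rightarrow> _" where "h \<phi> = (case \<phi> of Less l c \<Rightarrow> (l, c) | Less_Eq l c \<Rightarrow> (l, c))" for \<phi>
  show ?thesis
  proof
    show "finite (h ` \<Union>F)" using F by blast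
    fix x y :: "'r list" assume xy: "length x = k" "length y = k" "sgeq k (h ` \<Union>F) ((!) x) ((!) y)"
    have "satisfies (*s) x \<phi> \<longleftrightarrow> satisfies (*s) y \<phi>" if "\<phi> \<in> \<Union>F" for \<phi>
    proof -
      have s: "u < c \<longleftrightarrow> sg (u - c) = - 1" "u \<le> c \<longleftrightarrow> sg (u - c) \<noteq> 1" for u c :: 'r
        by (simp_all add: sg_eq_minus_1_iff sg_eq_1_iff not_less)
      have "case h \<phi> of (l, c) \<Rightarrow> sg (lin (*s) k l ((!) x) - c) = sg (lin (*s) k l ((!) y) - c)"
        by (rule xy(3)[unfolded sgeq_def, THEN bspec]) (use that in blast)
      then show ?thesis using xy(1,2)
        by (cases \<phi>) (simp_all add: h_def lin_def s)
    qed
    then show "x \<in> X \<longleftrightarrow> y \<in> X" using xy(1,2) unfolding F(3) coord_space_def by auto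
  qed
qed

lemma infinite_coord_space:
  assumes "1 \<le> k" shows "infinite (coord_space k :: 'r list set)"
proof
  assume "finite (coord_space k :: 'r list set)"
  moreover have "range (replicate k) \<subseteq> (coord_space k :: 'r list set)" by (auto simp: coord_space_def)
  ultimately have "finite (range (replicate k :: 'r \<Rightarrow> _))" by (rule finite_subset[rotated])
  moreover have "inj (replicate k :: 'r \<Rightarrow> _)" using assms by (auto simp: inj_def replicate_eq_replicate)
  ultimately have fin: "finite (UNIV :: 'r set)" by (rule finite_imageD)
  obtain e :: 'r where e: "0 < e" using ex_pos by blast
  have "Max UNIV + e \<le> (Max UNIV :: 'r)" using fin by (intro Max_ge) auto
  then show False using e by (simp add: not_less[symmetric])
qed

end

text \<open>The empty \<open>A\<close> is excluded because its single trace would violate a bound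
  with \<open>0 ^ s = 0\<close>. The lower half has the shape the grid delivers, \<open>s\<close>
  blocks of \<open>k\<close> points, and is converted by \<open>k = t div s\<close>.\<close>

definition trace_growth :: "'a set \<Rightarrow> ('b \<Rightarrow> 'a set) \<Rightarrow> 'b set \<Rightarrow> nat \<Rightarrow> bool" where
  "trace_growth U S P s \<longleftrightarrow>
     (\<exists>C. \<forall>A. finite A \<longrightarrow> A \<noteq> {} \<longrightarrow> A \<subseteq> U \<longrightarrow> card ((\<lambda>b. S b \<inter> A) ` P) \<le> C * card A ^ s) \<and>
     (\<forall>k. \<exists>A B. finite A \<and> A \<subseteq> U \<and> card A \<le> s * k \<and> finite B \<and> B \<subseteq> P \<and> card B = k ^ s \<and>
        inj_on (\<lambda>b. S b \<inter> A) B)"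

context piece
begin

lemma trace_growth_rank:
  fixes S :: "'r list \<Rightarrow> 'r list set"
  assumes mem: "\<And>a b. length a = m \<Longrightarrow> b \<in> coord_space n \<Longrightarrow> (!) b \<in> Y \<Longrightarrow> a \<in> S b \<longleftrightarrow> Ep (H ((!) a) ((!) b))"
  shows "trace_growth (coord_space m) S {b \<in> coord_space n. (!) b \<in> Y} rank"
  unfolding trace_growth_def
proof (intro conjI allI)
  define P where "P = {b \<in> coord_space n. (!) b \<in> Y}"
  have "card ((\<lambda>b. S b \<inter> A) ` P) \<le> ((rank + 1) * card Sig ^ rank * card (sign_vectors N)) * card A ^ rank"
    if A: "finite A" "A \<noteq> {}" "A \<subseteq> coord_space m" for A
  proof -
    have "S b \<inter> A = trace A (!) ((!) b)" if "b \<in> P" for b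
      using mem that A(3) unfolding trace_def coord_space_def P_def by blast
    then have sub: "(\<lambda>b. S b \<inter> A) ` P \<subseteq> trace A (!) ` Y" by (auto simp: P_def)
    note le = card_traces_le[OF A(1,2), of "(!)"]
    show ?thesis using card_mono[OF le(1) sub] le(2) by (rule le_trans)
  qed
  then show "\<exists>C. \<forall>A. finite A \<longrightarrow> A \<noteq> {} \<longrightarrow> A \<subseteq> coord_space m \<longrightarrow>
      card ((\<lambda>b. S b \<inter> A) ` {b \<in> coord_space n. (!) b \<in> Y}) \<le> C * card A ^ rank"
    unfolding P_def by blast
next
  fix k
  obtain A B where AB: "finite A" "card A \<le> rank * k" "finite B" "B \<subseteq> Y" "card B = k ^ rank"
    and sep: "\<And>b b'. b \<in> B \<Longrightarrow> b' \<in> B \<Longrightarrow> b \<noteq> b' \<Longrightarrow> \<exists>a\<in>A. Ep (H a b) \<noteq> Ep (H a b')"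
    using ex_separated[of k] by blast
  define la where "la a = map a [0..<m]" for a :: "nat \<Rightarrow> 'r"
  define lb where "lb b = map b [0..<n]" for b :: "nat \<Rightarrow> 'r"
  have Hl: "H ((!) (la a)) ((!) (lb b)) = H a b" for a b
  proof -
    have "lin (*s) m l ((!) (la a)) = lin (*s) m l a" "lin (*s) n l ((!) (lb b)) = lin (*s) n l b" for l
      by (auto simp: la_def lb_def intro!: lin_cong)
    then show ?thesis by (simp only: sgns_def)
  qed
  have lbP: "lb b \<in> coord_space n" "(!) (lb b) \<in> Y" if "b \<in> B" for b
  proof -
    show "lb b \<in> coord_space n" by (simp add: lb_def coord_space_def)
    have "sgeq n L b0 ((!) (lb b)) \<longleftrightarrow> sgeq n L b0 b" by (intro sgeq_cong) (auto simp: lb_def)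
    then show "(!) (lb b) \<in> Y" using that AB(4) unfolding Y_def by auto
  qed
  have m': "la a \<in> S (lb b) \<longleftrightarrow> Ep (H a b)" if "b \<in> B" for a b
    using mem[of "la a" "lb b"] lbP[OF that] by (simp add: Hl) (simp add: la_def)
  have ne: "S (lb b) \<inter> la ` A \<noteq> S (lb b') \<inter> la ` A" if b: "b \<in> B" "b' \<in> B" "b \<noteq> b'" for b b'
  proof -
    obtain a where a: "a \<in> A" "Ep (H a b) \<noteq> Ep (H a b')" using sep[OF b] by blast
    then have "la a \<in> S (lb b) \<inter> la ` A \<longleftrightarrow> \<not> la a \<in> S (lb b') \<inter> la ` A"
      using m'[OF b(1), of a] m'[OF b(2), of a] by blast
    then show ?thesis by blast
  qed
  have "inj_on ((\<lambda>b. S b \<inter> la ` A) \<circ> lb) B"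
  proof (rule inj_onI, rule ccontr)
    fix b b' assume "b \<in> B" "b' \<in> B" "((\<lambda>b. S b \<inter> la ` A) \<circ> lb) b = ((\<lambda>b. S b \<inter> la ` A) \<circ> lb) b'" "b \<noteq> b'"
    then show False using ne[of b b'] by simp
  qed
  then have inj: "inj_on lb B" "inj_on (\<lambda>b. S b \<inter> la ` A) (lb ` B)"
    by (rule inj_on_imageI2, rule inj_on_imageI)
  then have "card (lb ` B) = k ^ rank" using AB(5) by (simp add: card_image)
  moreover note inj(2)
  moreover have "card (la ` A) \<le> rank * k" using card_image_le[OF AB(1), of la] AB(2) by (rule le_trans)
  moreover have "la ` A \<subseteq> coord_space m" by (auto simp: la_def coord_space_def)
  ultimately show "\<exists>A B. finite A \<and> A \<subseteq> coord_space m \<and> card A \<le> rank * k \<and> finite B \<and>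
      B \<subseteq> {b \<in> coord_space n. (!) b \<in> Y} \<and> card B = k ^ rank \<and> inj_on (\<lambda>b. S b \<inter> A) B"
    using AB(1,3) lbP by (intro exI[of _ "la ` A"] exI[of _ "lb ` B"]) auto
qed

end

text \<open>The pieces are the sign classes in \<open>Y\<close> for the forms that decide
  \<open>Y\<close> itself together with those that decide where each sign vector occurs. The former
  keep a class inside \<open>Y\<close>, the latter give \<open>spread\<close>.\<close>

lemma (in left_ovs) ex_pieces:
  fixes S :: "'r list \<Rightarrow> 'r list set"
  assumes "semilinear_set_system (*s) m n Y S"
  shows "\<exists>\<P>. finite \<P> \<and> \<Union>\<P> = Y \<and> (\<forall>P\<in>\<P>. \<exists>s\<le>n. trace_growth (coord_space m) S P s)"
proof -
  have Y: "Y \<subseteq> coord_space n" and S: "\<And>b. b \<in> Y \<Longrightarrow> S b \<subseteq> coord_space m"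
    and slY: "semilinear (*s) n Y" and slE: "semilinear (*s) (m + n) {a @ b | a b. b \<in> Y \<and> a \<in> S b}"
    using assms unfolding semilinear_set_system_def by auto
  obtain LY where LY: "finite LY"
    "\<And>x y. length x = n \<Longrightarrow> length y = n \<Longrightarrow> sgeq n LY ((!) x) ((!) y) \<Longrightarrow> x \<in> Y \<longleftrightarrow> y \<in> Y"
    using semilinear_signs[OF slY] by blast
  obtain LE where LE: "finite LE"
    "\<And>x y. length x = m + n \<Longrightarrow> length y = m + n \<Longrightarrow> sgeq (m + n) LE ((!) x) ((!) y) \<Longrightarrow>
       x \<in> {a @ b | a b. b \<in> Y \<and> a \<in> S b} \<longleftrightarrow> y \<in> {a @ b | a b. b \<in> Y \<and> a \<in> S b}"
    using semilinear_signs[OF slE] by blast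
  obtain N and g :: "nat \<Rightarrow> (nat \<Rightarrow> 'd) \<times> 'r" where g: "LE = g ` {i. i < N}"
    using finite_imp_nat_seg_image_inj_on[OF LE(1)] by blast
  define f where "f i = fst (g i)" for i
  define G where "G i = (\<lambda>j. fst (g i) (m + j))" for i
  define c where "c i = snd (g i)" for i
  let ?H = "\<lambda>a b :: 'r list. sgns m n N f G c ((!) a) ((!) b)"
  \<comment> \<open>The sign vectors of actual members. The forms of \<open>LE\<close> decide
    membership, so one predicate serves all pieces.\<close>
  define Ep where "Ep \<sigma> \<longleftrightarrow> (\<exists>a b. length a = m \<and> b \<in> Y \<and> a \<in> S b \<and> ?H a b = \<sigma>)" for \<sigma>
  have mem: "a \<in> S b \<longleftrightarrow> Ep (?H a b)" if a: "length a = m" and b: "b \<in> Y" for a b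
  proof
    assume "Ep (?H a b)"
    then obtain a' b' where ab: "length a' = m" "b' \<in> Y" "a' \<in> S b'" "?H a' b' = ?H a b" unfolding Ep_def by blast
    have len: "length b = n" "length b' = n" using Y b ab(2) by (auto simp: coord_space_def)
    have lin: "lin (*s) (m + n) l ((!) (a @ b)) = lin (*s) m l ((!) a) + lin (*s) n (\<lambda>j. l (m + j)) ((!) b)"
      if "length a = m" for a b :: "'r list" and l
      unfolding lin_join[symmetric] by (intro lin_cong) (simp add: nth_append that)
    have "sgeq (m + n) LE ((!) (a @ b)) ((!) (a' @ b'))"
      unfolding sgeq_def g
    proof (intro ballI, clarify)
      fix l e i assume i: "(l, e) = g i" "i < N"
      have "?H a b i = ?H a' b' i" using ab(4) by simp
      then show "sg (lin (*s) (m + n) l ((!) (a @ b)) - e) = sg (lin (*s) (m + n) l ((!) (a' @ b')) - e)"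
        using i(2) unfolding lin[OF a] lin[OF ab(1)] by (simp add: sgns_def f_def G_def c_def flip: i(1))
    qed
    moreover have "a' @ b' \<in> {a @ b | a b. b \<in> Y \<and> a \<in> S b}" using ab by blast
    ultimately have "a @ b \<in> {a @ b | a b. b \<in> Y \<and> a \<in> S b}" using LE(2)[of "a @ b" "a' @ b'"] a ab(1) len by simp
    then obtain a'' b'' where "a @ b = a'' @ b''" "b'' \<in> Y" "a'' \<in> S b''" by blast
    moreover then have "length b'' = n" using Y by (auto simp: coord_space_def)
    ultimately show "a \<in> S b" using len(1) by simp
  qed (use a b in \<open>auto simp: Ep_def\<close>)
  have "\<forall>\<sigma>\<in>sign_vectors N. \<exists>L. finite L \<and> (\<forall>x y. sgeq n L x y \<longrightarrow>
     (x \<in> {b. \<exists>a. sgns m n N f G c a b = \<sigma>} \<longleftrightarrow> y \<in> {b. \<exists>a. sgns m n N f G c a b = \<sigma>}))"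
    by (intro ballI) (rule semilin_realised[unfolded semilin_def])
  from bchoice[OF this] obtain LS where LS': "\<forall>\<sigma>\<in>sign_vectors N. finite (LS \<sigma>) \<and> (\<forall>x y. sgeq n (LS \<sigma>) x y \<longrightarrow>
     (x \<in> {b. \<exists>a. sgns m n N f G c a b = \<sigma>} \<longleftrightarrow> y \<in> {b. \<exists>a. sgns m n N f G c a b = \<sigma>}))"
    by (elim exE)
  have LS: "\<sigma> \<in> sign_vectors N \<Longrightarrow> finite (LS \<sigma>)"
    "\<sigma> \<in> sign_vectors N \<Longrightarrow> sgeq n (LS \<sigma>) x y \<Longrightarrow>
      (\<exists>a. sgns m n N f G c a x = \<sigma>) \<longleftrightarrow> (\<exists>a. sgns m n N f G c a y = \<sigma>)" for \<sigma> x y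
    using LS' by simp_all
  define L where "L = LY \<union> (\<Union>\<sigma>\<in>sign_vectors N. LS \<sigma>)"
  have finL: "finite L" using LY(1) LS(1) finite_sign_vectors by (simp add: L_def)
  have piece: "piece (*s) m n N f G c L b0" for b0
  proof (intro piece.intro piece_axioms.intro left_ovs_axioms finL)
    fix b b' a assume "sgeq n L b0 b" "sgeq n L b0 b'"
    then have bb: "sgeq n L b b'" using sgeq_sym sgeq_trans by blast
    have s: "sgns m n N f G c a b \<in> sign_vectors N"
      using sg_range[where 'a = 'r] by (auto simp: sign_vectors_def sgns_def simp del: insert_iff)
    then have "sgeq n (LS (sgns m n N f G c a b)) b b'" using sgeq_mono[OF bb] unfolding L_def by blast
    then show "\<exists>a'. sgns m n N f G c a' b' = sgns m n N f G c a b" using LS(2)[OF s] by blast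
  qed
  define cl where "cl b = {b' \<in> coord_space n. sgeq n L ((!) b) ((!) b')}" for b :: "'r list"
  have "cl ` Y \<subseteq> (\<lambda>Z. {b' \<in> coord_space n. (!) b' \<in> Z}) ` range (\<lambda>x. {y. sgeq n L x y})"
    unfolding cl_def by auto
  then have "finite (cl ` Y)" by (rule finite_subset) (intro finite_imageI finite_sgclasses finL)
  moreover have "cl b \<subseteq> Y" if "b \<in> Y" for b
  proof
    fix b' assume b': "b' \<in> cl b"
    then have "sgeq n L ((!) b) ((!) b')" by (simp add: cl_def)
    then have "sgeq n LY ((!) b) ((!) b')" by (rule sgeq_mono) (simp add: L_def)
    then show "b' \<in> Y" using LY(2)[of b b'] that b' Y by (auto simp: coord_space_def cl_def)
  qed
  note sub = this
  then have "\<Union>(cl ` Y) = Y" using Y sgeq_refl by (auto simp: cl_def)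
  moreover have "\<exists>s\<le>n. trace_growth (coord_space m) S (cl r) s" if r: "r \<in> Y" for r
  proof -
    interpret piece "(*s)" m n N f G c L "(!) r" Ep by (rule piece)
    have "cl r = {b \<in> coord_space n. (!) b \<in> piece.Y (*s) n L ((!) r)}"
      by (simp add: cl_def Y_def)
    moreover have "trace_growth (coord_space m) S {b \<in> coord_space n. (!) b \<in> piece.Y (*s) n L ((!) r)} rank"
    proof (rule trace_growth_rank)
      fix a b :: "'r list"
      assume "length a = m" "b \<in> coord_space n" "(!) b \<in> piece.Y (*s) n L ((!) r)"
      then show "a \<in> S b \<longleftrightarrow> Ep (sgns m n N f G c ((!) a) ((!) b))"
        using sub[OF r] by (intro mem) (auto simp: cl_def Y_def)
    qed
    ultimately show ?thesis using rank_le by auto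
  qed
  ultimately show ?thesis by (intro exI[of _ "cl ` Y"]) auto
qed

section \<open>From the pieces to the shatter function\<close>

lemma finite_traces: "finite {card {T \<inter> A | T. T \<in> \<S>} | A. A \<subseteq> U \<and> finite A \<and> card A = t}"
proof (rule finite_subset)
  show "{card {T \<inter> A | T. T \<in> \<S>} | A. A \<subseteq> U \<and> finite A \<and> card A = t} \<subseteq> {..2 ^ t}"
  proof clarify
    fix A :: "'a set" assume "finite A" "t = card A"
    then have "card {T \<inter> A | T. T \<in> \<S>} \<le> card (Pow A)" by (intro card_mono) auto
    then show "card {T \<inter> A | T. T \<in> \<S>} \<le> 2 ^ card A" using \<open>finite A\<close> by (simp add: card_Pow)
  qed
qed simp

lemma shatter_function_ge:
  assumes "A \<subseteq> U" "finite A" "card A = t"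
  shows "card ((\<lambda>T. T \<inter> A) ` \<S>) \<le> shatter_function U \<S> t"
proof -
  have "(\<lambda>T. T \<inter> A) ` \<S> = {T \<inter> A | T. T \<in> \<S>}" by blast
  then show ?thesis unfolding shatter_function_def using assms
    by (intro Max_ge finite_traces) auto
qed

lemma shatter_function_attained:
  assumes "infinite U"
  obtains A where "A \<subseteq> U" "finite A" "card A = t" "shatter_function U \<S> t = card ((\<lambda>T. T \<inter> A) ` \<S>)"
proof -
  let ?M = "{card {T \<inter> A | T. T \<in> \<S>} | A. A \<subseteq> U \<and> finite A \<and> card A = t}"
  obtain A where "A \<subseteq> U" "finite A" "card A = t" using infinite_arbitrarily_large[OF assms] by blast
  then have "?M \<noteq> {}" by blast
  then have "shatter_function U \<S> t \<in> ?M"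
    unfolding shatter_function_def by (intro Max_in finite_traces)
  then obtain A where "A \<subseteq> U" "finite A" "card A = t"
    "shatter_function U \<S> t = card {T \<inter> A | T. T \<in> \<S>}" by blast
  moreover have "(\<lambda>T. T \<inter> A) ` \<S> = {T \<inter> A | T. T \<in> \<S>}" by blast
  ultimately show ?thesis using that by simp
qed

lemma ex_superset_card:
  assumes "infinite U" "A \<subseteq> U" "finite A" "card A \<le> t"
  obtains B where "A \<subseteq> B" "B \<subseteq> U" "finite B" "card B = t"
proof -
  have "infinite (U - A)" using assms by simp
  then obtain C where C: "C \<subseteq> U - A" "finite C" "card C = t - card A"
    using infinite_arbitrarily_large by blast
  have "card (A \<union> C) = t" using C assms by (subst card_Un_disjoint) auto
  then show ?thesis using that[of "A \<union> C"] C assms by auto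
qed

text \<open>For \<open>t \<ge> s > 0\<close> the quotient \<open>t div s\<close> is at least
  \<open>t / (2 * s)\<close>; for \<open>t < s\<close> that fraction is at most 1 and
  \<open>1 \<le> k\<close> suffices. The factor \<open>1 / 2\<close> makes the bound strict.\<close>

lemma floor_power_bound:
  assumes "(t div s) ^ s \<le> k" "1 \<le> k"
  shows "(1 / 2) * (1 / (2 * real s)) ^ s * real t ^ s < real k"
proof -
  have "(1 / (2 * real s)) ^ s * real t ^ s \<le> real k"
  proof (cases "s = 0")
    case False
    define x where "x = real t / (2 * real s)"
    have x0: "0 \<le> x" by (simp add: x_def)
    have "x ^ s \<le> real k"
    proof (cases "t div s = 0")
      case True
      then have "t < s" using False by (simp add: div_eq_0_iff)
      then have "x \<le> 1" using False by (simp add: x_def)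
      then have "x ^ s \<le> 1" using x0 by (simp add: power_le_one)
      then show ?thesis using assms(2) by linarith
    next
      case True': False
      have "t < s * (t div s + 1)" using False by (metis dividend_less_times_div mult.commute mult_Suc_right Suc_eq_plus1 neq0_conv add.commute)
      also have "\<dots> \<le> s * (2 * (t div s))" using True' by (intro mult_le_mono2) simp
      finally have "real t < real (s * (2 * (t div s)))" by (simp only: of_nat_less_iff)
      then have "x \<le> real (t div s)" using False by (simp add: x_def divide_le_eq mult_ac)
      then have "x ^ s \<le> real (t div s) ^ s" using x0 by (intro power_mono)
      also have "\<dots> = real ((t div s) ^ s)" by simp
      also have "\<dots> \<le> real k" using assms(1) by (simp only: of_nat_le_iff)
      finally show ?thesis .
    qed
    moreover have "(1 / (2 * real s)) ^ s * real t ^ s = x ^ s"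
      unfolding x_def power_mult_distrib[symmetric] by simp
    ultimately show ?thesis by simp
  qed (use assms in simp)
  then show ?thesis using assms(2) by simp
qed

theorem theorem7p5:
  fixes scale ::
      "'d::{division_ring, linordered_ring_strict} \<Rightarrow>
       'r::{linordered_ab_group_add, dense_linorder, zero_neq_one} \<Rightarrow> 'r"
    and m n :: nat
    and Y :: "'r list set"
    and S :: "'r list \<Rightarrow> 'r list set"
  assumes "ordered_left_vector_space scale"
    and "m \<ge> 1"
    and "Y \<noteq> {}"
    and "semilinear_set_system scale m n Y S"
  shows "\<exists>C\<^sub>1 C\<^sub>2 :: real. \<exists>s :: nat. C\<^sub>1 > 0 \<and> C\<^sub>2 > 0 \<and> s \<le> n \<and>
    (\<forall>t::nat. t \<ge> 1 \<longrightarrow>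
       C\<^sub>1 * real t ^ s < real (shatter_function (coord_space m) (S ` Y) t) \<and>
       real (shatter_function (coord_space m) (S ` Y) t) < C\<^sub>2 * real t ^ s)"
proof -
  interpret ordered_left_vector_space scale by fact
  have inf: "infinite (coord_space m :: 'r list set)" using assms(2) by (rule infinite_coord_space)
  obtain R where R: "finite R" "\<Union>R = Y" and "\<forall>P\<in>R. \<exists>s\<le>n. trace_growth (coord_space m) S P s"
    using ex_pieces[OF assms(4)] by blast
  then obtain d where d: "\<And>P. P \<in> R \<Longrightarrow> d P \<le> n"
    and growth: "\<And>P. P \<in> R \<Longrightarrow> trace_growth (coord_space m) S P (d P)"
    by metis
  then have "\<exists>C. \<forall>A. finite A \<longrightarrow> A \<noteq> {} \<longrightarrow> A \<subseteq> coord_space m \<longrightarrow> card ((\<lambda>b. S b \<inter> A) ` P) \<le> C * card A ^ d P"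
    if "P \<in> R" for P using that unfolding trace_growth_def by blast
  then obtain C where C: "\<And>P A. P \<in> R \<Longrightarrow> finite A \<Longrightarrow> A \<noteq> {} \<Longrightarrow> A \<subseteq> coord_space m \<Longrightarrow>
      card ((\<lambda>b. S b \<inter> A) ` P) \<le> C P * card A ^ d P"
    by metis
  have "R \<noteq> {}" using R(2) assms(3) by blast
  \<comment> \<open>The largest exponent dominates the others as \<open>t \<ge> 1\<close>, and its
    piece alone supplies the lower bound.\<close>
  define s where "s = Max (d ` R)"
  have "s \<in> d ` R" unfolding s_def using R(1) \<open>R \<noteq> {}\<close> by (intro Max_in) auto
  then obtain r0 where r0: "r0 \<in> R" "d r0 = s" by auto
  have ds: "d r \<le> s" if "r \<in> R" for r unfolding s_def using R(1) that by (intro Max_ge) auto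
  let ?\<pi> = "shatter_function (coord_space m) (S ` Y)"
  have up: "?\<pi> t \<le> sum C R * t ^ s" if t: "1 \<le> t" for t
  proof -
    obtain A where A: "A \<subseteq> coord_space m" "finite A" "card A = t"
      "?\<pi> t = card ((\<lambda>T. T \<inter> A) ` S ` Y)"
      using shatter_function_attained[OF inf, of t] by blast
    have ne: "A \<noteq> {}" using A(3) t by auto
    have "(\<lambda>T. T \<inter> A) ` S ` Y \<subseteq> (\<Union>r\<in>R. (\<lambda>b. S b \<inter> A) ` r)" using R(2) by blast
    moreover have "finite ((\<lambda>b. S b \<inter> A) ` r)" for r
      by (rule finite_subset[of _ "Pow A"]) (use A(2) in auto)
    ultimately have "?\<pi> t \<le> card (\<Union>r\<in>R. (\<lambda>b. S b \<inter> A) ` r)"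
      unfolding A(4) using R(1) by (intro card_mono) auto
    also have "\<dots> \<le> (\<Sum>r\<in>R. card ((\<lambda>b. S b \<inter> A) ` r))" by (rule card_UN_le[OF R(1)])
    also have "\<dots> \<le> (\<Sum>r\<in>R. C r * t ^ s)"
    proof (rule sum_mono)
      fix r assume r: "r \<in> R"
      have "card ((\<lambda>b. S b \<inter> A) ` r) \<le> C r * t ^ d r"
        using C[OF r A(2) ne A(1)] A(3) by simp
      also have "\<dots> \<le> C r * t ^ s" using t ds[OF r] by (intro mult_le_mono2 power_increasing)
      finally show "card ((\<lambda>b. S b \<inter> A) ` r) \<le> C r * t ^ s" .
    qed
    also have "\<dots> = sum C R * t ^ s" by (rule sum_distrib_right[symmetric])
    finally show ?thesis .
  qed
  \<comment> \<open>For \<open>s = 0\<close> the left-hand side is 1, since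
    \<open>t div 0 = 0\<close> and \<open>0 ^ 0 = 1\<close>.\<close>
  have low: "(t div s) ^ s \<le> ?\<pi> t" and pos: "1 \<le> ?\<pi> t" for t
  proof -
    obtain A B where AB: "finite A" "A \<subseteq> coord_space m" "card A \<le> s * (t div s)" "finite B"
        "B \<subseteq> r0" "card B = (t div s) ^ s" "inj_on (\<lambda>b. S b \<inter> A) B"
      using growth[OF r0(1), unfolded trace_growth_def r0(2), THEN conjunct2, THEN spec, of "t div s"]
      by (elim exE conjE) (rule that)
    have "B \<subseteq> Y" using AB(5) r0(1) R(2) by blast
    \<comment> \<open>Padding to exactly \<open>t\<close> points is harmless: traces that differ on
      \<open>A\<close> differ on every larger set.\<close>
    have "card A \<le> t" using AB(3) by (meson le_trans times_div_less_eq_dividend)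
    then obtain A' where A': "A \<subseteq> A'" "A' \<subseteq> coord_space m" "finite A'" "card A' = t"
      using ex_superset_card[OF inf AB(2,1)] by blast
    have le: "card ((\<lambda>T. T \<inter> A') ` S ` Y) \<le> ?\<pi> t" using A' by (intro shatter_function_ge)
    have fin: "finite ((\<lambda>T. T \<inter> A') ` S ` Y)"
      by (rule finite_subset[of _ "Pow A'"]) (use A'(3) in auto)
    have "inj_on (\<lambda>b. S b \<inter> A') B"
    proof (rule inj_onI)
      fix b b' assume b: "b \<in> B" "b' \<in> B" "S b \<inter> A' = S b' \<inter> A'"
      then have "S b \<inter> A = S b' \<inter> A" using A'(1) by blast
      then show "b = b'" using AB(7) b(1,2) by (simp add: inj_on_def)
    qed
    then have "(t div s) ^ s = card ((\<lambda>b. S b \<inter> A') ` B)" using AB(6) by (simp add: card_image)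
    also have "\<dots> \<le> card ((\<lambda>T. T \<inter> A') ` S ` Y)" using fin \<open>B \<subseteq> Y\<close> by (intro card_mono) auto
    finally show "(t div s) ^ s \<le> ?\<pi> t" using le by (rule le_trans)
    have "(\<lambda>T. T \<inter> A') ` S ` Y \<noteq> {}" using assms(3) by blast
    then show "1 \<le> ?\<pi> t" using le fin by (metis One_nat_def Suc_leI card_gt_0_iff le_trans)
  qed
  show ?thesis
  proof (intro exI conjI allI impI)
    show "0 < (1 / 2) * (if s = 0 then 1 else (1 / (2 * real s)) ^ s)" by simp
    \<comment> \<open>The summand 1 keeps the constant positive and makes the upper bound
      strict.\<close>
    show "0 < real (sum C R) + 1" by linarith
    show "s \<le> n" using d r0 by auto
    fix t :: nat assume t: "1 \<le> t"
    show "(1 / 2) * (if s = 0 then 1 else (1 / (2 * real s)) ^ s) * real t ^ s < real (?\<pi> t)"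
      using floor_power_bound[OF low pos, of t] by (cases "s = 0") auto
    have "real (?\<pi> t) \<le> real (sum C R * t ^ s)" using up[OF t] by (simp only: of_nat_le_iff)
    also have "\<dots> < (real (sum C R) + 1) * real t ^ s" using t by (simp add: distrib_right)
    finally show "real (?\<pi> t) < (real (sum C R) + 1) * real t ^ s" .
  qed
qed

end
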